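(* Let $(N,h)$ be a Riemannian manifold, $M^4$ a compact orientable $4$-manifold, $\phi:M\to N$ an immersion, $\rho\in C^\infty(M)$ and $g=e^{2\rho}\phi^{*}h$, so that $\phi:(M^4,g)\to(N,h)$ is a conformal immersion. If the biharmonic stress-energy tensor $S_2$ of $\phi:(M^4,g)\to(N,h)$ vanishes, then $\rho$ is constant and $\overline\phi:(M^4,\phi^{*}h)\to (N,h)$, $\overline\phi=\phi$, is a pseudo-umbilical Riemannian immersion.
   Context: All manifolds, metrics and maps are smooth; manifolds are connected and without boundary. For a map $\phi:(M^m,g)\to(N,h)$, the tension field is $\tau(\phi)=\operatorname{trace}_g\nabla d\phi$, a section of $\phi^{-1}TN$, and the biharmonic stress-energy tensor is the symmetric $(0,2)$-tensor field on $M$ $$S_2(X,Y)=\tfrac12|\tau(\phi)|^2\langle X,Y\rangle+\langle d\phi,\nabla\tau(\phi)\rangle\langle X,Y\rangle-\langle d\phi(X),\nabla_Y\tau(\phi)\rangle-\langle d\phi(Y),\nabla_X\tau(\phi)\rangle,$$ where $\nabla\tau(\phi)$ uses the pull-back connection on $\phi^{-1}TN$ and $\langle d\phi,\nabla\tau(\phi)\rangle=\sum_i\langle d\phi(e_i),\nabla_{e_i}\tau(\phi)\rangle$ for a local orthonormal frame $\{e_i\}$. A Riemannian immersion $\phi:(M^m,g)\to(N,h)$ is an immersion with $g=\phi^*h$; with second fundamental form $B=\nabla d\phi$, it is pseudo-umbilical if $\langle B(X,Y),\tau(\phi)\rangle=\frac1m|\tau(\phi)|^2\langle X,Y\rangle$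 for all vector fields $X,Y$ on $M$. *)

theory Defs
  imports "HOL-Analysis.Analysis"
begin

text \<open>
  Tensor fields are handled in the classical way: as families of components, one for each chart
  of an atlas, subject to the usual transformation law. A tangent vector at a point is represented,
  relative to a chart, by its coordinate vector.
\<close>

section \<open>Smooth maps between Euclidean spaces\<close>

abbreviation dirder :: "('a::real_normed_vector \<Rightarrow> 'b::real_normed_vector) \<Rightarrow> 'a \<Rightarrow> 'a \<Rightarrow> 'b" where
  "dirder f x v \<equiv> frechet_derivative f (at x) v"

text \<open>Of class $C^k$ on an open set. The set is meant to be open: derivatives are taken in the full space.\<close>

primrec Ck_on :: "nat \<Rightarrow> 'a::real_normed_vector set \<Rightarrow> ('a \<Rightarrow> 'b::real_normed_vector) \<Rightarrow> bool" where
  "Ck_on 0 U f \<longleftrightarrow> continuous_on U f"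
| "Ck_on (Suc k) U f \<longleftrightarrow>
     (\<forall>x\<in>U. f differentiable (at x)) \<and> (\<forall>v. Ck_on k U (\<lambda>x. dirder f x v))"

definition smooth_on :: "'a::real_normed_vector set \<Rightarrow> ('a \<Rightarrow> 'b::real_normed_vector) \<Rightarrow> bool" where
  "smooth_on U f \<longleftrightarrow> (\<forall>k. Ck_on k U f)"


section \<open>Riemannian geometry in local coordinates\<close>

text \<open>
  Below, \<open>G\<close> and \<open>H\<close> are the component matrices of metrics on open subsets of two Euclidean spaces,
  as functions of the coordinates, and \<open>f\<close> is a map from the first subset to the second.
\<close>

definition metric_inner :: "real^'k^'k \<Rightarrow> real^'k \<Rightarrow> real^'k \<Rightarrow> real" where
  "metric_inner G v w = v \<bullet> (G *v w)"

lemma matrix_inv: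
  fixes G :: "real^'k^'k"
  assumes "invertible G"
  shows matrix_inv_left: "matrix_inv G ** G = mat 1" and matrix_inv_right: "G ** matrix_inv G = mat 1"
proof -
  have "G ** matrix_inv G = mat 1 \<and> matrix_inv G ** G = mat 1"
    using assms unfolding invertible_def matrix_inv_def by (rule someI_ex)
  then show "matrix_inv G ** G = mat 1" "G ** matrix_inv G = mat 1" by auto
qed

text \<open>The trace $g^{ij}b(\partial_i,\partial_j)$ of a bilinear form.\<close>

definition metric_trace ::
    "real^'k^'k \<Rightarrow> (real^'k \<Rightarrow> real^'k \<Rightarrow> 'v::real_vector) \<Rightarrow> 'v" where
  "metric_trace G b =
     (\<Sum>i\<in>UNIV. \<Sum>j\<in>UNIV. (matrix_inv G $ i $ j) *\<^sub>R b (axis i 1) (axis j 1))"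

text \<open>Christoffel symbols $\Gamma^k_{ij}=\frac12 g^{kl}(\partial_i g_{jl}+\partial_j g_{il}-\partial_l g_{ij})$.\<close>

definition christoffel :: "(real^'k \<Rightarrow> real^'k^'k) \<Rightarrow> real^'k \<Rightarrow> 'k \<Rightarrow> 'k \<Rightarrow> 'k \<Rightarrow> real" where
  "christoffel G x k i j =
     1/2 * (\<Sum>l\<in>UNIV. matrix_inv (G x) $ k $ l *
              (dirder (\<lambda>y. G y $ j $ l) x (axis i 1) + dirder (\<lambda>y. G y $ i $ l) x (axis j 1)
               - dirder (\<lambda>y. G y $ i $ j) x (axis l 1)))"

definition conn_form :: "(real^'k \<Rightarrow> real^'k^'k) \<Rightarrow> real^'k \<Rightarrow> real^'k \<Rightarrow> real^'k \<Rightarrow> real^'k" where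
  "conn_form G x X Y = (\<chi> k. \<Sum>i\<in>UNIV. \<Sum>j\<in>UNIV. christoffel G x k i j * X $ i * Y $ j)"

text \<open>The Christoffel symbols define the torsion-free metric connection.\<close>

lemma christoffel_levi_civita:
  fixes G :: "real^'k \<Rightarrow> real^'k^'k"
  assumes S: "open S" "x \<in> S" and sym: "\<And>y. y \<in> S \<Longrightarrow> transpose (G y) = G y"
    and inv: "invertible (G x)"
  shows "christoffel G x k i j = christoffel G x k j i"
    and "dirder (\<lambda>y. G y $ j $ l) x (axis i 1) =
           (\<Sum>k\<in>UNIV. G x $ k $ l * christoffel G x k i j) + (\<Sum>k\<in>UNIV. G x $ j $ k * christoffel G x k i l)"
proof -
  have Gs: "G y $ j $ l = G y $ l $ j" if "y \<in> S" for y j l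
    using sym[OF that] by (metis transpose_def vec_lambda_beta)
  have d_iff: "((\<lambda>y. G y $ j $ l) has_derivative D) (at x) \<longleftrightarrow> ((\<lambda>y. G y $ l $ j) has_derivative D) (at x)" for D j l
    using has_derivative_transform_within_open[OF _ S, of "\<lambda>y. G y $ j $ l" D UNIV "\<lambda>y. G y $ l $ j"]
      has_derivative_transform_within_open[OF _ S, of "\<lambda>y. G y $ l $ j" D UNIV "\<lambda>y. G y $ j $ l"]
      Gs[of _ j l] by auto
  have ds: "dirder (\<lambda>y. G y $ j $ l) x v = dirder (\<lambda>y. G y $ l $ j) x v" for j l v
    unfolding frechet_derivative_def by (simp add: d_iff[of j l])
  show "christoffel G x k i j = christoffel G x k j i"
    unfolding christoffel_def by (simp add: ds[of i j] add.commute)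
  have low: "(\<Sum>k\<in>UNIV. G x $ l $ k * christoffel G x k i j) =
      1/2 * (dirder (\<lambda>y. G y $ j $ l) x (axis i 1) + dirder (\<lambda>y. G y $ i $ l) x (axis j 1)
               - dirder (\<lambda>y. G y $ i $ j) x (axis l 1))" for l i j
  proof -
    define w :: "real^'k" where "w = (\<chi> l. 1/2 * (dirder (\<lambda>y. G y $ j $ l) x (axis i 1)
               + dirder (\<lambda>y. G y $ i $ l) x (axis j 1) - dirder (\<lambda>y. G y $ i $ j) x (axis l 1)))"
    have c: "christoffel G x k i j = (matrix_inv (G x) *v w) $ k" for k
      by (simp add: christoffel_def w_def matrix_vector_mult_def sum_distrib_left mult.left_commute)
    have "(\<Sum>k\<in>UNIV. G x $ l $ k * christoffel G x k i j) = (G x *v (matrix_inv (G x) *v w)) $ l"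
      unfolding c by (simp add: matrix_vector_mult_def)
    also have "\<dots> = w $ l"
      by (simp add: matrix_vector_mul_assoc matrix_inv_right[OF inv])
    finally show ?thesis by (simp add: w_def)
  qed
  show "dirder (\<lambda>y. G y $ j $ l) x (axis i 1) =
           (\<Sum>k\<in>UNIV. G x $ k $ l * christoffel G x k i j) + (\<Sum>k\<in>UNIV. G x $ j $ k * christoffel G x k i l)"
    unfolding Gs[OF S(2), of _ l] low
    by (simp add: ds[of l j] field_simps)
qed

text \<open>The covariant derivative along \<open>X\<close> of a section \<open>V\<close> of the pull-back bundle of \<open>f\<close>.\<close>

definition pullback_conn ::
    "(real^'n \<Rightarrow> real^'n^'n) \<Rightarrow> (real^'m \<Rightarrow> real^'n) \<Rightarrow> (real^'m \<Rightarrow> real^'n) \<Rightarrow> real^'m \<Rightarrow> real^'m \<Rightarrow> real^'n" where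
  "pullback_conn H f V x X = dirder V x X + conn_form H (f x) (dirder f x X) (V x)"

text \<open>$(\nabla df)(X,Y)=\nabla_X(df(Y))-df(\nabla_X Y)$, for \<open>Y\<close> with constant coefficients.\<close>

definition hess_map ::
    "(real^'m \<Rightarrow> real^'m^'m) \<Rightarrow> (real^'n \<Rightarrow> real^'n^'n) \<Rightarrow> (real^'m \<Rightarrow> real^'n) \<Rightarrow> real^'m \<Rightarrow> real^'m \<Rightarrow> real^'m \<Rightarrow> real^'n" where
  "hess_map G H f x X Y = pullback_conn H f (\<lambda>y. dirder f y Y) x X - dirder f x (conn_form G x X Y)"

definition tension ::
    "(real^'m \<Rightarrow> real^'m^'m) \<Rightarrow> (real^'n \<Rightarrow> real^'n^'n) \<Rightarrow> (real^'m \<Rightarrow> real^'n) \<Rightarrow> real^'m \<Rightarrow> real^'n" where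
  "tension G H f x = metric_trace (G x) (hess_map G H f x)"

definition bienergy_stress ::
    "(real^'m \<Rightarrow> real^'m^'m) \<Rightarrow> (real^'n \<Rightarrow> real^'n^'n) \<Rightarrow> (real^'m \<Rightarrow> real^'n) \<Rightarrow> real^'m \<Rightarrow> real^'m \<Rightarrow> real^'m \<Rightarrow> real" where
  "bienergy_stress G H f x X Y =
     (let \<tau> = tension G H f;
          D\<tau> = pullback_conn H f \<tau> x;
          df = dirder f x;
          g = metric_inner (G x);
          h = metric_inner (H (f x))
      in 1/2 * h (\<tau> x) (\<tau> x) * g X Y
         + metric_trace (G x) (\<lambda>Z W. h (df Z) (D\<tau> W)) * g X Y
         - h (df X) (D\<tau> Y) - h (df Y) (D\<tau> X))"

text \<open>\<open>metric_trace\<close> is the sum over an orthonormal frame.\<close>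

lemma metric_trace_orthonormal:
  fixes G :: "real^'k^'k" and e :: "'k \<Rightarrow> real^'k" and b :: "real^'k \<Rightarrow> real^'k \<Rightarrow> 'v::real_vector"
  assumes e: "\<And>i j. metric_inner G (e i) (e j) = (if i = j then 1 else 0)"
    and b1: "\<And>v. linear (\<lambda>w. b v w)" and b2: "\<And>w. linear (\<lambda>v. b v w)"
  shows "metric_trace G b = (\<Sum>i\<in>UNIV. b (e i) (e i))"
proof -
  define E :: "real^'k^'k" where "E = (\<chi> i. e i)"
  have row: "row i E = e i" for i
    by (simp add: E_def row_def vec_eq_iff)
  have "E ** (G ** transpose E) = mat 1"
  proof -
    have "(E ** (G ** transpose E)) $ i $ j = mat 1 $ i $ j" for i j
    proof -
      have "(E ** (G ** transpose E)) $ i $ j = e i \<bullet> (G *v e j)"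
        unfolding matrix_matrix_mult_def matrix_vector_mult_def inner_vec_def transpose_def E_def
        by simp
      then show ?thesis using e[of i j] by (simp add: metric_inner_def mat_def)
    qed
    then show ?thesis by (simp add: vec_eq_iff)
  qed
  then have "(G ** transpose E) ** E = mat 1"
    using matrix_left_right_inverse by blast
  then have R: "G ** (transpose E ** E) = mat 1"
    by (simp add: matrix_mul_assoc)
  then have "(transpose E ** E) ** G = mat 1"
    using matrix_left_right_inverse by blast
  then have "invertible G"
    using R unfolding invertible_def by blast
  then have "matrix_inv G ** (G ** (transpose E ** E)) = transpose E ** E"
    by (simp add: matrix_mul_assoc matrix_inv_left[OF \<open>invertible G\<close>])
  then have inv: "matrix_inv G = transpose E ** E"
    by (simp add: R)
  have expand: "b v w = (\<Sum>k\<in>UNIV. \<Sum>l\<in>UNIV. (v $ k * w $ l) *\<^sub>R b (axis k 1) (axis l 1))" for v w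
  proof -
    have bw: "v = (\<Sum>k\<in>UNIV. (v $ k) *\<^sub>R axis k 1)" for v :: "real^'k"
      using basis_expansion[of v] by (simp add: scalar_mult_eq_scaleR)
    have "b v w = (\<Sum>k\<in>UNIV. (v $ k) *\<^sub>R b (axis k 1) w)"
      by (subst bw[of v])
        (simp add: linear_sum[OF b2] linear_cmul[OF b2])
    also have "\<dots> = (\<Sum>k\<in>UNIV. (v $ k) *\<^sub>R (\<Sum>l\<in>UNIV. (w $ l) *\<^sub>R b (axis k 1) (axis l 1)))"
      by (subst (1) bw[of w])
        (simp add: linear_sum[OF b1] linear_cmul[OF b1])
    finally show ?thesis by (simp add: scaleR_right.sum)
  qed
  have "metric_trace G b = (\<Sum>k\<in>UNIV. \<Sum>l\<in>UNIV. \<Sum>i\<in>UNIV. (e i $ k * e i $ l) *\<^sub>R b (axis k 1) (axis l 1))"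
    unfolding metric_trace_def inv
    by (simp add: matrix_matrix_mult_def transpose_def E_def scaleR_left.sum)
  also have "\<dots> = (\<Sum>k\<in>UNIV. \<Sum>i\<in>UNIV. \<Sum>l\<in>UNIV. (e i $ k * e i $ l) *\<^sub>R b (axis k 1) (axis l 1))"
    by (intro sum.cong refl sum.swap)
  also have "\<dots> = (\<Sum>i\<in>UNIV. \<Sum>k\<in>UNIV. \<Sum>l\<in>UNIV. (e i $ k * e i $ l) *\<^sub>R b (axis k 1) (axis l 1))"
    by (rule sum.swap)
  also have "\<dots> = (\<Sum>i\<in>UNIV. b (e i) (e i))"
    by (simp add: expand[symmetric])
  finally show ?thesis .
qed


section \<open>Smooth manifolds\<close>

text \<open>A chart is its domain together with its coordinate map; the values of the map outside the domain are irrelevant.\<close>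

type_synonym ('a, 'm) chart = "'a set \<times> ('a \<Rightarrow> real^'m)"

abbreviation dom_of :: "('a, 'm::finite) chart \<Rightarrow> 'a set" where "dom_of \<equiv> fst"
abbreviation coord :: "('a, 'm::finite) chart \<Rightarrow> 'a \<Rightarrow> real^'m" where "coord \<equiv> snd"
abbreviation param :: "('a, 'm::finite) chart \<Rightarrow> real^'m \<Rightarrow> 'a" where
  "param c \<equiv> inv_into (dom_of c) (coord c)"

definition chart_on :: "'a topology \<Rightarrow> ('a, 'm::finite) chart \<Rightarrow> bool" where
  "chart_on T c \<longleftrightarrow> openin T (dom_of c) \<and> open (coord c ` dom_of c) \<and>
     homeomorphic_map (subtopology T (dom_of c)) (top_of_set (coord c ` dom_of c)) (coord c)"

definition transition :: "('a, 'm::finite) chart \<Rightarrow> ('a, 'm) chart \<Rightarrow> real^'m \<Rightarrow> real^'m" where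
  "transition c d = coord d \<circ> param c"

definition compatible :: "('a, 'm::finite) chart \<Rightarrow> ('a, 'm) chart \<Rightarrow> bool" where
  "compatible c d \<longleftrightarrow> smooth_on (coord c ` (dom_of c \<inter> dom_of d)) (transition c d)
                  \<and> smooth_on (coord d ` (dom_of c \<inter> dom_of d)) (transition d c)"

definition smooth_atlas :: "'a topology \<Rightarrow> ('a, 'm::finite) chart set \<Rightarrow> bool" where
  "smooth_atlas T A \<longleftrightarrow> (\<forall>c\<in>A. chart_on T c) \<and> (\<Union>c\<in>A. dom_of c) = topspace T \<and>
     (\<forall>c\<in>A. \<forall>d\<in>A. compatible c d)"

record ('a, 'm) mfd =
  mtop :: "'a topology"
  atlas :: "('a, 'm) chart set"

definition smooth_manifold :: "('a, 'm::finite) mfd \<Rightarrow> bool" where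
  "smooth_manifold M \<longleftrightarrow> Hausdorff_space (mtop M) \<and> second_countable (mtop M) \<and>
     connected_space (mtop M) \<and> smooth_atlas (mtop M) (atlas M)"

definition orientable :: "('a, 'm::finite) mfd \<Rightarrow> bool" where
  "orientable M \<longleftrightarrow> (\<exists>B. smooth_atlas (mtop M) B \<and> (\<forall>c\<in>atlas M. \<forall>d\<in>B. compatible c d) \<and>
     (\<forall>c\<in>B. \<forall>d\<in>B. \<forall>p\<in>dom_of c \<inter> dom_of d. det (jacobian (transition c d) (at (coord c p))) > 0))"

definition smooth_function :: "('a, 'm::finite) mfd \<Rightarrow> ('a \<Rightarrow> real) \<Rightarrow> bool" where
  "smooth_function M u \<longleftrightarrow> (\<forall>c\<in>atlas M. smooth_on (coord c ` dom_of c) (u \<circ> param c))"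

text \<open>Coordinate representation of a map; meaningful on \<open>coord c ` (dom_of c \<inter> \<phi> -` dom_of d)\<close>.\<close>

definition map_rep ::
    "('a \<Rightarrow> 'b) \<Rightarrow> ('a, 'm::finite) chart \<Rightarrow> ('b, 'n::finite) chart \<Rightarrow> real^'m \<Rightarrow> real^'n" where
  "map_rep \<phi> c d = coord d \<circ> \<phi> \<circ> param c"

definition smooth_map :: "('a, 'm::finite) mfd \<Rightarrow> ('b, 'n::finite) mfd \<Rightarrow> ('a \<Rightarrow> 'b) \<Rightarrow> bool" where
  "smooth_map M N \<phi> \<longleftrightarrow> continuous_map (mtop M) (mtop N) \<phi> \<and>
     (\<forall>c\<in>atlas M. \<forall>d\<in>atlas N. smooth_on (coord c ` (dom_of c \<inter> \<phi> -` dom_of d)) (map_rep \<phi> c d))"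

definition immersion :: "('a, 'm::finite) mfd \<Rightarrow> ('b, 'n::finite) mfd \<Rightarrow> ('a \<Rightarrow> 'b) \<Rightarrow> bool" where
  "immersion M N \<phi> \<longleftrightarrow> smooth_map M N \<phi> \<and>
     (\<forall>c\<in>atlas M. \<forall>d\<in>atlas N. \<forall>p\<in>dom_of c \<inter> \<phi> -` dom_of d. inj (dirder (map_rep \<phi> c d) (coord c p)))"


section \<open>Riemannian metrics, stress-energy tensor, pseudo-umbilical immersions\<close>

text \<open>\<open>g c p\<close> is the matrix of components at the point \<open>p\<close> with respect to the chart \<open>c\<close>.\<close>

type_synonym ('a, 'm) tensor2 = "('a, 'm) chart \<Rightarrow> 'a \<Rightarrow> real^'m^'m"

definition metric_rep :: "('a, 'm::finite) tensor2 \<Rightarrow> ('a, 'm) chart \<Rightarrow> real^'m \<Rightarrow> real^'m^'m" where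
  "metric_rep g c = g c \<circ> param c"

definition riemannian_metric :: "('a, 'm::finite) mfd \<Rightarrow> ('a, 'm) tensor2 \<Rightarrow> bool" where
  "riemannian_metric M g \<longleftrightarrow>
     (\<forall>c\<in>atlas M. smooth_on (coord c ` dom_of c) (metric_rep g c)) \<and>
     (\<forall>c\<in>atlas M. \<forall>p\<in>dom_of c. transpose (g c p) = g c p \<and> (\<forall>v. v \<noteq> 0 \<longrightarrow> metric_inner (g c p) v v > 0)) \<and>
     (\<forall>c\<in>atlas M. \<forall>d\<in>atlas M. \<forall>p\<in>dom_of c \<inter> dom_of d. 
        let J = jacobian (transition c d) (at (coord c p)) in g c p = transpose J ** g d p ** J)"

text \<open>
  The pull-back of \<open>h\<close>. If \<open>h\<close> is a Riemannian metric and \<open>\<phi>\<close> is smooth, then the value does not depend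
  on the chart \<open>d\<close> around \<open>\<phi> p\<close>.
\<close>

definition pullback_metric ::
    "('b, 'n::finite) mfd \<Rightarrow> ('b, 'n) tensor2 \<Rightarrow> ('a \<Rightarrow> 'b) \<Rightarrow> ('a, 'm::finite) tensor2" where
  "pullback_metric N h \<phi> c p =
     (let d = (SOME d. d \<in> atlas N \<and> \<phi> p \<in> dom_of d);
          J = jacobian (map_rep \<phi> c d) (at (coord c p))
      in transpose J ** h d (\<phi> p) ** J)"

definition conformal_change :: "('a \<Rightarrow> real) \<Rightarrow> ('a, 'm::finite) tensor2 \<Rightarrow> ('a, 'm) tensor2" where
  "conformal_change \<rho> g c p = exp (2 * \<rho> p) *\<^sub>R g c p"

text \<open>
  The component expressions of the previous sections are invariant under changes of charts, hence the
  conditions below are imposed for all choices of a chart around the point and a chart around its image.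
\<close>

definition stress_energy_vanishes ::
    "('a, 'm::finite) mfd \<Rightarrow> ('a, 'm) tensor2 \<Rightarrow> ('b, 'n::finite) mfd \<Rightarrow> ('b, 'n) tensor2 \<Rightarrow> ('a \<Rightarrow> 'b) \<Rightarrow> bool" where
  "stress_energy_vanishes M g N h \<phi> \<longleftrightarrow>
     (\<forall>c\<in>atlas M. \<forall>d\<in>atlas N. \<forall>p\<in>dom_of c \<inter> \<phi> -` dom_of d. \<forall>X Y.
        bienergy_stress (metric_rep g c) (metric_rep h d) (map_rep \<phi> c d) (coord c p) X Y = 0)"

definition riemannian_immersion ::
    "('a, 'm::finite) mfd \<Rightarrow> ('a, 'm) tensor2 \<Rightarrow> ('b, 'n::finite) mfd \<Rightarrow> ('b, 'n) tensor2 \<Rightarrow> ('a \<Rightarrow> 'b) \<Rightarrow> bool" where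
  "riemannian_immersion M g N h \<phi> \<longleftrightarrow> riemannian_metric M g \<and> immersion M N \<phi> \<and>
     (\<forall>c\<in>atlas M. \<forall>p\<in>dom_of c. g c p = pullback_metric N h \<phi> c p)"

definition pseudo_umbilical ::
    "('a, 'm::finite) mfd \<Rightarrow> ('a, 'm) tensor2 \<Rightarrow> ('b, 'n::finite) mfd \<Rightarrow> ('b, 'n) tensor2 \<Rightarrow> ('a \<Rightarrow> 'b) \<Rightarrow> bool" where
  "pseudo_umbilical M g N h \<phi> \<longleftrightarrow>
     (\<forall>c\<in>atlas M. \<forall>d\<in>atlas N. \<forall>p\<in>dom_of c \<inter> \<phi> -` dom_of d. \<forall>X Y.
        let B = hess_map (metric_rep g c) (metric_rep h d) (map_rep \<phi> c d) (coord c p);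
            \<tau> = tension (metric_rep g c) (metric_rep h d) (map_rep \<phi> c d) (coord c p);
            ip = metric_inner (h d (\<phi> p))
        in ip (B X Y) \<tau> = 1 / real CARD('m) * ip \<tau> \<tau> * metric_inner (g c p) X Y)"

end

theory Submission
  imports Defs
begin

text \<open>
  Write $\bar g=\phi^*h$, $u=e^{-2\rho}$, and let $B$ and $\bar\tau$ be the second fundamental form and the
  tension field of the isometric immersion. The tangential part of $\tau$ is given by
  $\langle\tau,d\phi(Z)\rangle=2u\,d\rho(Z)$; differentiating this identity expresses
  $\langle d\phi(X),\nabla_Y\tau\rangle$, and hence $S_2$, by $\rho$, $\bar\tau$ and $B$. In dimension four
  the terms in $\bar\tau$ cancel in the trace of $S_2$, which leaves $\Delta_{\bar g}\,\rho=0$. So $\rho$ is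
  constant by the strong maximum principle, and
  $S_2=0$ then reads $\langle B(X,Y),\bar\tau\rangle=\frac14|\bar\tau|^2\langle X,Y\rangle$.
\<close>

section \<open>Calculus of smooth maps\<close>

text \<open>The trace of S_2 with respect to g is (m/2)|\<tau>|^2 + (m-2)<d\<phi>, \<nabla>\<tau>>,
  and <d\<phi>, \<nabla>\<tau>> is the divergence of the tangential part of \<tau> minus |\<tau>|^2.
  The weights m/2 and m-2 agree exactly for m = 4; then only the divergence survives, and it
  involves \<rho> alone. S_2 sees \<nabla>\<tau> only through products with tangential vectors, so
  one derivative of a scalar identity is all that has to be taken. The isometric immersion is
  treated as the case \<rho> = 0 of the conformal one, so that each identity serves both metrics.
  Constancy is reached locally as well: in each chart the points where \<rho> equals a given upper
  bound form an open set, which is also closed by continuity.\<close>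

lemma has_derivative_dirder: "f differentiable (at x) \<Longrightarrow> (f has_derivative dirder f x) (at x)"
  by (simp add: frechet_derivative_works)

lemma dirder_eqI: "(f has_derivative D) (at x) \<Longrightarrow> dirder f x = D"
  by (rule frechet_derivative_at[symmetric])

text \<open>\<open>frechet_derivative\<close> is a choice among all candidate derivatives, and f and
  g have the same candidates at x; so the equality holds even where neither is
  differentiable.\<close>

lemma dirder_cong_open:
  assumes "open U" "x \<in> U" "\<And>y. y \<in> U \<Longrightarrow> f y = g y"
  shows "dirder f x = dirder g x"
proof -
  have "(f has_derivative D) (at x) \<longleftrightarrow> (g has_derivative D) (at x)" for D
    using has_derivative_transform_within_open[OF _ assms(1,2), of f D UNIV g]
      has_derivative_transform_within_open[OF _ assms(1,2), of g D UNIV f] assms(3) by auto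
  then show ?thesis unfolding frechet_derivative_def by simp
qed

lemma differentiable_cong_open:
  assumes "f differentiable (at x)" "open U" "x \<in> U" "\<And>y. y \<in> U \<Longrightarrow> f y = g y"
  shows "g differentiable (at x)"
  using has_derivative_transform_within_open[OF _ assms(2,3), of f _ UNIV g] assms(1,4)
  unfolding differentiable_def by blast

text \<open>The rules for derivatives of sums, products and compositions hold on U only, while
  \<open>dirder\<close> is a total function. This transfer turns each of them into a regularity
  statement; openness lets equality on U pass to the derivatives at points of U.\<close>

lemma Ck_on_cong:
  assumes "open U" "\<And>x. x \<in> U \<Longrightarrow> f x = g x" "Ck_on k U f"
  shows "Ck_on k U g"
  using assms(2,3)
proof (induction k arbitrary: f g)
  case 0
  then show ?case using continuous_on_cong[of U U f g] by simp
next
  case (Suc k)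
  have "g differentiable (at x)" if "x \<in> U" for x
    using differentiable_cong_open[OF _ assms(1) that, of f g] Suc.prems that by simp
  moreover have "Ck_on k U (\<lambda>x. dirder g x v)" for v
  proof (rule Suc.IH)
    show "Ck_on k U (\<lambda>x. dirder f x v)" using Suc.prems by simp
    show "dirder f x v = dirder g x v" if "x \<in> U" for x
      using dirder_cong_open[OF assms(1) that, of f g] Suc.prems by simp
  qed
  ultimately show ?case by simp
qed

lemma Ck_on_Suc_imp: "Ck_on (Suc k) U f \<Longrightarrow> Ck_on k U f"
proof (induction k arbitrary: f)
  case 0
  then have "continuous_on U f"
    by (intro continuous_at_imp_continuous_on) (auto intro: differentiable_imp_continuous_within)
  then show ?case by simp
next
  case (Suc k)
  then show ?case by (metis Ck_on.simps(2))
qed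

lemma Ck_on_subset: "Ck_on k U f \<Longrightarrow> V \<subseteq> U \<Longrightarrow> Ck_on k V f"
  by (induction k arbitrary: f) (auto intro: continuous_on_subset)

lemma Ck_on_local:
  assumes "\<And>x. x \<in> U \<Longrightarrow> \<exists>V. open V \<and> x \<in> V \<and> Ck_on k V f"
  shows "Ck_on k U f"
  using assms
proof (induction k arbitrary: f)
  case 0
  have "isCont f x" if "x \<in> U" for x
    using 0[OF that] continuous_on_eq_continuous_at by fastforce
  then show ?case by (simp add: continuous_at_imp_continuous_on)
next
  case (Suc k)
  have "f differentiable (at x)" if "x \<in> U" for x
    using Suc.prems[OF that] by auto
  moreover have "Ck_on k U (\<lambda>x. dirder f x v)" for v
  proof (rule Suc.IH)
    fix x assume "x \<in> U"
    from Suc.prems[OF this] show "\<exists>V. open V \<and> x \<in> V \<and> Ck_on k V (\<lambda>x. dirder f x v)" by auto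
  qed
  ultimately show ?case by simp
qed

lemma Ck_on_const: "Ck_on k U (\<lambda>x. c)"
  by (induction k arbitrary: c) auto

lemma Ck_on_add:
  assumes "open U" "Ck_on k U f" "Ck_on k U g"
  shows "Ck_on k U (\<lambda>x. f x + g x)"
  using assms(2,3)
proof (induction k arbitrary: f g)
  case 0
  then show ?case by (simp add: continuous_on_add)
next
  case (Suc k)
  have "Ck_on k U (\<lambda>x. dirder (\<lambda>y. f y + g y) x v)" for v
  proof (rule Ck_on_cong[OF assms(1)])
    show "Ck_on k U (\<lambda>x. dirder f x v + dirder g x v)"
      by (rule Suc.IH) (use Suc.prems in simp_all)
    show "dirder f x v + dirder g x v = dirder (\<lambda>y. f y + g y) x v" if "x \<in> U" for x
      using has_derivative_add[OF has_derivative_dirder has_derivative_dirder, of f x g] Suc.prems that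
      by (simp add: dirder_eqI)
  qed
  then show ?case using Suc.prems by auto
qed

lemma Ck_on_sum:
  assumes "open U" "\<And>i. i \<in> I \<Longrightarrow> Ck_on k U (f i)"
  shows "Ck_on k U (\<lambda>x. \<Sum>i\<in>I. f i x)"
  using assms(2)
  by (induction I rule: infinite_finite_induct) (auto intro: Ck_on_const Ck_on_add[OF assms(1)])

text \<open>The Leibniz rule pairs the derivative of one factor with the other factor itself, so the
  induction step also needs the factors one order lower, which \<open>Ck_on_Suc_imp\<close>
  supplies. One bilinear proof covers products, scalings and inner products.\<close>

lemma Ck_on_bounded_bilinear:
  fixes f :: "'d::real_normed_vector \<Rightarrow> 'a::real_normed_vector" and g :: "'d \<Rightarrow> 'b::real_normed_vector"
    and p :: "'a \<Rightarrow> 'b \<Rightarrow> 'c::real_normed_vector"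
  assumes p: "bounded_bilinear p" and "open U" "Ck_on k U f" "Ck_on k U g"
  shows "Ck_on k U (\<lambda>x. p (f x) (g x))"
  using assms(3,4)
proof (induction k arbitrary: f g)
  case 0
  then show ?case by (simp add: bounded_bilinear.continuous_on[OF p])
next
  case (Suc k)
  have D: "((\<lambda>y. p (f y) (g y)) has_derivative (\<lambda>h. p (f x) (dirder g x h) + p (dirder f x h) (g x))) (at x)"
    if "x \<in> U" for x
    using bounded_bilinear.FDERIV[OF p has_derivative_dirder has_derivative_dirder, of f x g] Suc.prems that by simp
  have "Ck_on k U (\<lambda>x. dirder (\<lambda>y. p (f y) (g y)) x v)" for v
  proof (rule Ck_on_cong[OF assms(2)])
    show "Ck_on k U (\<lambda>x. p (f x) (dirder g x v) + p (dirder f x v) (g x))"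
      using Suc.prems by (intro Ck_on_add[OF assms(2)] Suc.IH) (auto intro: Ck_on_Suc_imp)
  qed (simp add: dirder_eqI[OF D])
  then show ?case using D by (auto simp: differentiable_def)
qed

lemmas Ck_on_mult = Ck_on_bounded_bilinear[OF bounded_bilinear_mult]
lemmas Ck_on_scaleR = Ck_on_bounded_bilinear[OF bounded_bilinear_scaleR]
lemmas Ck_on_inner = Ck_on_bounded_bilinear[OF bounded_bilinear_inner]

lemma Ck_on_bounded_linear:
  assumes "open U" "bounded_linear L" "Ck_on k U f"
  shows "Ck_on k U (\<lambda>x. L (f x))"
  using assms(3)
proof (induction k arbitrary: f)
  case 0
  then show ?case using bounded_linear.continuous_on[OF assms(2)] by simp
next
  case (Suc k)
  have D: "((\<lambda>y. L (f y)) has_derivative (\<lambda>h. L (dirder f x h))) (at x)" if "x \<in> U" for x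
    by (rule bounded_linear.has_derivative[OF assms(2) has_derivative_dirder]) (use Suc.prems that in simp)
  have "Ck_on k U (\<lambda>x. dirder (\<lambda>y. L (f y)) x v)" for v
  proof (rule Ck_on_cong[OF assms(1)])
    show "Ck_on k U (\<lambda>x. L (dirder f x v))" using Suc by simp
  qed (simp add: dirder_eqI[OF D])
  then show ?case using D by (auto simp: differentiable_def)
qed

lemma linear_expand_Basis:
  fixes D :: "'b::euclidean_space \<Rightarrow> 'c::real_vector"
  assumes "linear D"
  shows "D w = (\<Sum>b\<in>Basis. (w \<bullet> b) *\<^sub>R D b)"
proof -
  have "D w = D (\<Sum>b\<in>Basis. (w \<bullet> b) *\<^sub>R b)" by (simp add: euclidean_representation)
  then show ?thesis by (simp add: linear_sum[OF assms] linear_cmul[OF assms])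
qed

lemma Ck_on_compose:
  fixes f :: "'a::real_normed_vector \<Rightarrow> 'b::euclidean_space"
  assumes U: "open U" and V: "f ` U \<subseteq> V" and f: "Ck_on k U f" and g: "Ck_on k V g"
  shows "Ck_on k U (\<lambda>x. g (f x))"
  using f g
proof (induction k arbitrary: g)
  case 0
  then show ?case using continuous_on_compose2[of V g U f] V by simp
next
  case (Suc k)
  have D: "((\<lambda>y. g (f y)) has_derivative (\<lambda>h. dirder g (f x) (dirder f x h))) (at x)" if "x \<in> U" for x
    using has_derivative_compose[OF has_derivative_dirder has_derivative_dirder, of f x g] Suc.prems that V
    by auto
  have "Ck_on k U (\<lambda>x. dirder (\<lambda>y. g (f y)) x v)" for v
  proof (rule Ck_on_cong[OF U])
    \<comment> \<open>\<open>Ck_on\<close> differentiates in fixed directions, whereas the chain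
      rule feeds the moving direction \<open>dirder f x v\<close> into the derivative of g.
      Expansion over \<open>Basis\<close> trades it for fixed directions with moving coefficients;
      this is why the middle space is Euclidean.\<close>
    show "Ck_on k U (\<lambda>x. \<Sum>b\<in>Basis. (dirder f x v \<bullet> b) *\<^sub>R dirder g (f x) b)"
    proof (intro Ck_on_sum[OF U] Ck_on_scaleR[OF U] Ck_on_inner[OF U] Ck_on_const)
      show "Ck_on k U (\<lambda>x. dirder f x v)" using Suc.prems by simp
      show "Ck_on k U (\<lambda>x. dirder g (f x) b)" for b
        by (rule Suc.IH) (use Suc.prems Ck_on_Suc_imp in auto)
    qed
    show "(\<Sum>b\<in>Basis. (dirder f x v \<bullet> b) *\<^sub>R dirder g (f x) b) = dirder (\<lambda>y. g (f y)) x v" if "x \<in> U" for x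
    proof -
      have "linear (dirder g (f x))"
        using Suc.prems that V by (intro linear_frechet_derivative) auto
      then show ?thesis
        by (simp add: dirder_eqI[OF D[OF that]] linear_expand_Basis[of "dirder g (f x)" "dirder f x v"])
    qed
  qed
  then show ?case using D by (auto simp: differentiable_def)
qed

lemma Ck_on_exp:
  fixes f :: "'a::real_normed_vector \<Rightarrow> real"
  assumes "open U" "Ck_on k U f"
  shows "Ck_on k U (\<lambda>x. exp (f x))"
  using assms(2)
proof (induction k)
  case 0
  then show ?case by (simp add: continuous_on_exp)
next
  case (Suc k)
  have D: "((\<lambda>y. exp (f y)) has_derivative (\<lambda>h. exp (f x) * dirder f x h)) (at x)" if "x \<in> U" for x
    using has_derivative_exp[OF has_derivative_dirder, of f x] Suc.prems that
    by (simp add: mult_ac)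
  have "Ck_on k U (\<lambda>x. dirder (\<lambda>y. exp (f y)) x v)" for v
  proof (rule Ck_on_cong[OF assms(1)])
    show "Ck_on k U (\<lambda>x. exp (f x) * dirder f x v)"
      using Suc Ck_on_Suc_imp by (intro Ck_on_mult[OF assms(1)]) auto
  qed (simp add: dirder_eqI[OF D])
  then show ?case using D by (auto simp: differentiable_def)
qed

text \<open>The vector is rebuilt as a sum of bounded linear images of its components. Components
  may lie in any normed space, so the lemma applies twice to matrix-valued maps, whose components
  are rows.\<close>

lemma Ck_on_vec:
  fixes f :: "'a::real_normed_vector \<Rightarrow> 'b::real_normed_vector^'n"
  assumes "open U" "\<And>i. Ck_on k U (\<lambda>x. f x $ i)"
  shows "Ck_on k U f"
proof (rule Ck_on_cong[OF assms(1)])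
  have "linear (\<lambda>c. axis i c :: 'b^'n)" for i
    by (rule linearI) (simp_all add: vec_eq_iff axis_def)
  moreover have "norm (axis i c :: 'b^'n) \<le> norm c * 1" for i c
  proof -
    have "norm (axis i c :: 'b^'n) \<le> (\<Sum>j\<in>UNIV. norm ((axis i c :: 'b^'n) $ j))"
      unfolding norm_vec_def by (rule L2_set_le_sum) simp
    also have "\<dots> = (\<Sum>j\<in>UNIV. if j = i then norm c else 0)"
      by (rule sum.cong) (auto simp: axis_def)
    finally show ?thesis by simp
  qed
  ultimately have bl: "bounded_linear (\<lambda>c. axis i c :: 'b^'n)" for i
    using bounded_linear_intro[of "\<lambda>c. axis i c :: 'b^'n" 1]
    by (simp add: linear_add linear_cmul)
  show "Ck_on k U (\<lambda>x. \<Sum>i\<in>UNIV. axis i (f x $ i) :: 'b^'n)"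
    by (intro Ck_on_sum[OF assms(1)] Ck_on_bounded_linear[OF assms(1) bl] assms(2))
  show "(\<Sum>i\<in>UNIV. axis i (f x $ i) :: 'b^'n) = f x" for x
    by (simp add: vec_eq_iff axis_def if_distrib[of "\<lambda>g. g _"] cong: if_cong)
qed

lemma smooth_on_iff_dirder:
  "smooth_on U f \<longleftrightarrow> (\<forall>x\<in>U. f differentiable (at x)) \<and> (\<forall>v. smooth_on U (\<lambda>x. dirder f x v))"
  unfolding smooth_on_def by (metis Ck_on.simps(2) Ck_on_Suc_imp)

lemma smooth_on_differentiable: "smooth_on U f \<Longrightarrow> x \<in> U \<Longrightarrow> f differentiable (at x)"
  by (simp add: smooth_on_iff_dirder[of U f])

lemma smooth_on_dirder: "smooth_on U f \<Longrightarrow> smooth_on U (\<lambda>x. dirder f x v)"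
  by (simp add: smooth_on_iff_dirder[of U f])

lemma smooth_on_continuous: "smooth_on U f \<Longrightarrow> continuous_on U f"
  unfolding smooth_on_def by (metis Ck_on.simps(1))

lemma smooth_on_cong:
  "open U \<Longrightarrow> (\<And>x. x \<in> U \<Longrightarrow> f x = g x) \<Longrightarrow> smooth_on U f \<Longrightarrow> smooth_on U g"
  unfolding smooth_on_def using Ck_on_cong by blast

lemma smooth_on_subset: "smooth_on U f \<Longrightarrow> V \<subseteq> U \<Longrightarrow> smooth_on V f"
  unfolding smooth_on_def using Ck_on_subset by blast

lemma smooth_on_local:
  "(\<And>x. x \<in> U \<Longrightarrow> \<exists>V. open V \<and> x \<in> V \<and> smooth_on V f) \<Longrightarrow> smooth_on U f"
  unfolding smooth_on_def by (intro allI Ck_on_local) blast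

lemma smooth_on_const: "smooth_on U (\<lambda>x. c)"
  unfolding smooth_on_def by (simp add: Ck_on_const)

lemma smooth_on_sum: "open U \<Longrightarrow> (\<And>i. i \<in> I \<Longrightarrow> smooth_on U (f i)) \<Longrightarrow> smooth_on U (\<lambda>x. \<Sum>i\<in>I. f i x)"
  unfolding smooth_on_def by (simp add: Ck_on_sum)

lemma smooth_on_mult:
  fixes f g :: "'a::real_normed_vector \<Rightarrow> real"
  shows "open U \<Longrightarrow> smooth_on U f \<Longrightarrow> smooth_on U g \<Longrightarrow> smooth_on U (\<lambda>x. f x * g x)"
  unfolding smooth_on_def by (simp add: Ck_on_mult)

lemma smooth_on_exp:
  fixes f :: "'a::real_normed_vector \<Rightarrow> real"
  shows "open U \<Longrightarrow> smooth_on U f \<Longrightarrow> smooth_on U (\<lambda>x. exp (f x))"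
  unfolding smooth_on_def by (simp add: Ck_on_exp)

lemma smooth_on_compose:
  fixes f :: "'a::real_normed_vector \<Rightarrow> 'b::euclidean_space"
  shows "open U \<Longrightarrow> f ` U \<subseteq> V \<Longrightarrow> smooth_on U f \<Longrightarrow> smooth_on V g \<Longrightarrow> smooth_on U (\<lambda>x. g (f x))"
  unfolding smooth_on_def by (simp add: Ck_on_compose)

lemma smooth_on_vec:
  fixes f :: "'a::real_normed_vector \<Rightarrow> 'b::real_normed_vector^'n"
  shows "open U \<Longrightarrow> (\<And>i. smooth_on U (\<lambda>x. f x $ i)) \<Longrightarrow> smooth_on U f"
  unfolding smooth_on_def by (simp add: Ck_on_vec)

lemma smooth_on_vec_nth:
  fixes f :: "'a::real_normed_vector \<Rightarrow> 'b::real_normed_vector^'n"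
  shows "open U \<Longrightarrow> smooth_on U f \<Longrightarrow> smooth_on U (\<lambda>x. f x $ i)"
  unfolding smooth_on_def by (auto intro: Ck_on_bounded_linear[OF _ bounded_linear_vec_nth])

lemma differentiable_vec_nth:
  fixes f :: "'a::real_normed_vector \<Rightarrow> 'b::real_normed_vector^'n"
  shows "f differentiable (at x) \<Longrightarrow> (\<lambda>x. f x $ i) differentiable (at x)"
  unfolding differentiable_def using bounded_linear.has_derivative[OF bounded_linear_vec_nth] by blast

lemma dirder_vec_nth:
  fixes f :: "'a::real_normed_vector \<Rightarrow> 'b::real_normed_vector^'n"
  assumes "f differentiable (at x)"
  shows "dirder (\<lambda>x. f x $ i) x v = dirder f x v $ i"
  using dirder_eqI[OF bounded_linear.has_derivative[OF bounded_linear_vec_nth has_derivative_dirder[OF assms]]]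
  by simp

lemma smooth_on_id: "smooth_on U (\<lambda>x. x)"
proof -
  have "Ck_on k U (\<lambda>x::'a. x)" for k by (cases k) (simp_all add: Ck_on_const)
  then show ?thesis by (simp add: smooth_on_def)
qed

lemma smooth_on_inner: "open U \<Longrightarrow> smooth_on U f \<Longrightarrow> smooth_on U g \<Longrightarrow> smooth_on U (\<lambda>x. f x \<bullet> g x)"
  unfolding smooth_on_def by (simp add: Ck_on_inner)

lemma smooth_on_add: "open U \<Longrightarrow> smooth_on U f \<Longrightarrow> smooth_on U g \<Longrightarrow> smooth_on U (\<lambda>x. f x + g x)"
  unfolding smooth_on_def by (simp add: Ck_on_add)

lemma dirder_add:
  "f differentiable (at x) \<Longrightarrow> g differentiable (at x) \<Longrightarrow>
    dirder (\<lambda>y. f y + g y) x v = dirder f x v + dirder g x v"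
  by (subst dirder_eqI[OF has_derivative_add[OF has_derivative_dirder has_derivative_dirder]]) auto

lemma dirder_cmult:
  fixes f :: "'a::real_normed_vector \<Rightarrow> real"
  shows "f differentiable (at x) \<Longrightarrow> dirder (\<lambda>y. c * f y) x v = c * dirder f x v"
  by (subst dirder_eqI[OF has_derivative_mult_right[OF has_derivative_dirder]]) auto

section \<open>Restriction to lines and symmetry of second derivatives\<close>

lemma has_real_derivative_along_line:
  fixes F :: "'a::real_normed_vector \<Rightarrow> real"
  assumes "F differentiable (at (x + t *\<^sub>R v))"
  shows "((\<lambda>t. F (x + t *\<^sub>R v)) has_real_derivative dirder F (x + t *\<^sub>R v) v) (at t)"
proof -
  have "((\<lambda>t. x + t *\<^sub>R v) has_derivative (\<lambda>h. h *\<^sub>R v)) (at t)"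
    by (auto intro!: derivative_eq_intros)
  from has_derivative_compose[OF this has_derivative_dirder[OF assms]]
  have "((\<lambda>t. F (x + t *\<^sub>R v)) has_derivative (\<lambda>h. dirder F (x + t *\<^sub>R v) (h *\<^sub>R v))) (at t)" .
  moreover have "dirder F (x + t *\<^sub>R v) (h *\<^sub>R v) = dirder F (x + t *\<^sub>R v) v * h" for h
    using linear_cmul[OF linear_frechet_derivative[OF assms], of h v] by simp
  ultimately show ?thesis by (simp add: has_field_derivative_def)
qed

text \<open>The mean value theorem is used twice: along v on the difference of F over two parallel
  edges, then along w on the derivative of F in direction v.\<close>

lemma second_difference:
  fixes F :: "'a::real_normed_vector \<Rightarrow> real"
  assumes F: "smooth_on U F" and s: "s > 0"
    and U: "\<And>a b. 0 \<le> a \<Longrightarrow> a \<le> s \<Longrightarrow> 0 \<le> b \<Longrightarrow> b \<le> s \<Longrightarrow> x + a *\<^sub>R v + b *\<^sub>R w \<in> U"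
  shows "\<exists>a b. 0 < a \<and> a < s \<and> 0 < b \<and> b < s \<and>
    F (x + s *\<^sub>R v + s *\<^sub>R w) - F (x + s *\<^sub>R v) - F (x + s *\<^sub>R w) + F x
      = s * s * dirder (\<lambda>y. dirder F y v) (x + a *\<^sub>R v + b *\<^sub>R w) w"
proof -
  note d = smooth_on_differentiable[OF F] smooth_on_differentiable[OF smooth_on_dirder[OF F]]
  have "((\<lambda>t. F ((x + s *\<^sub>R w) + t *\<^sub>R v) - F (x + t *\<^sub>R v)) has_real_derivative
      dirder F ((x + s *\<^sub>R w) + t *\<^sub>R v) v - dirder F (x + t *\<^sub>R v) v) (at t)" if "0 \<le> t" "t \<le> s" for t
    using U[of t s] U[of t 0] that s
    by (intro DERIV_diff has_real_derivative_along_line d) (auto simp: algebra_simps)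
  from MVT2[OF s this] obtain a where a: "0 < a" "a < s"
    and eq: "F ((x + s *\<^sub>R w) + s *\<^sub>R v) - F (x + s *\<^sub>R v) - (F ((x + s *\<^sub>R w) + 0 *\<^sub>R v) - F (x + 0 *\<^sub>R v))
      = (s - 0) * (dirder F ((x + s *\<^sub>R w) + a *\<^sub>R v) v - dirder F (x + a *\<^sub>R v) v)"
    by blast
  have "((\<lambda>t. dirder F ((x + a *\<^sub>R v) + t *\<^sub>R w) v) has_real_derivative
      dirder (\<lambda>y. dirder F y v) ((x + a *\<^sub>R v) + t *\<^sub>R w) w) (at t)" if "0 \<le> t" "t \<le> s" for t
    using U[of a t] that a by (intro has_real_derivative_along_line d) auto
  from MVT2[OF s this] obtain b where b: "0 < b" "b < s"
    and eq2: "dirder F ((x + a *\<^sub>R v) + s *\<^sub>R w) v - dirder F ((x + a *\<^sub>R v) + 0 *\<^sub>R w) v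
      = (s - 0) * dirder (\<lambda>y. dirder F y v) ((x + a *\<^sub>R v) + b *\<^sub>R w) w"
    by blast
  show ?thesis
    using a b eq eq2 by (intro exI[of _ a] exI[of _ b]) (simp add: algebra_simps)
qed

text \<open>Swapping v and w leaves the second difference unchanged, so P at one point of a small
  parallelogram equals Q at another; continuity then forbids different values at x.\<close>

lemma dirder_commute_real:
  fixes F :: "'a::real_normed_vector \<Rightarrow> real"
  assumes U: "open U" "x \<in> U" and F: "smooth_on U F"
  shows "dirder (\<lambda>y. dirder F y v) x w = dirder (\<lambda>y. dirder F y w) x v"
proof (rule ccontr)
  define P Q where "P y = dirder (\<lambda>y. dirder F y v) y w" and "Q y = dirder (\<lambda>y. dirder F y w) y v" for y
  assume "\<not> ?thesis"
  then have e: "\<bar>P x - Q x\<bar> / 2 > 0" by (simp add: P_def Q_def)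
  have "isCont P x" "isCont Q x"
    using smooth_on_continuous[OF smooth_on_dirder[OF smooth_on_dirder[OF F]]] U
    unfolding P_def[abs_def] Q_def[abs_def] by (auto simp: continuous_on_eq_continuous_at)
  then obtain d1 d2 where d1: "d1 > 0" "\<And>y. dist y x < d1 \<Longrightarrow> dist (P y) (P x) < \<bar>P x - Q x\<bar> / 2"
    and d2: "d2 > 0" "\<And>y. dist y x < d2 \<Longrightarrow> dist (Q y) (Q x) < \<bar>P x - Q x\<bar> / 2"
    using e unfolding continuous_at_eps_delta by (metis dist_commute)
  obtain d3 where d3: "d3 > 0" "ball x d3 \<subseteq> U"
    using U open_contains_ball by blast
  define d where "d = min d1 (min d2 d3)"
  \<comment> \<open>The summand 1 keeps k positive when v and w both vanish; with
    \<open>s = d / (2 * k)\<close> the whole parallelogram lies within distance d / 2 of x.\<close>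
  define k where "k = norm v + norm w + 1"
  define s where "s = d / (2 * k)"
  have d: "d > 0" using d1 d2 d3 by (simp add: d_def)
  have n: "k > 0" by (simp add: k_def add_nonneg_pos)
  then have s: "s > 0" using d by (simp add: s_def)
  have close: "dist (x + a *\<^sub>R v + b *\<^sub>R w) x < d" if "0 \<le> a" "a \<le> s" "0 \<le> b" "b \<le> s" for a b
  proof -
    have "dist (x + a *\<^sub>R v + b *\<^sub>R w) x \<le> norm (a *\<^sub>R v) + norm (b *\<^sub>R w)"
      by (simp add: dist_norm norm_triangle_ineq add.assoc del: norm_scaleR)
    also have "\<dots> \<le> s * norm v + s * norm w"
      using that by (intro add_mono) (auto intro: mult_right_mono)
    also have "\<dots> \<le> s * k"
      using s by (simp add: k_def algebra_simps)
    also have "\<dots> = d / 2" using n by (simp add: s_def)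
    finally show ?thesis using d by simp
  qed
  have inU: "x + a *\<^sub>R v + b *\<^sub>R w \<in> U" if "0 \<le> a" "a \<le> s" "0 \<le> b" "b \<le> s" for a b
    using close[OF that] d3 by (auto simp: d_def dist_commute)
  obtain a b where ab: "0 < a" "a < s" "0 < b" "b < s" and
    P: "F (x + s *\<^sub>R v + s *\<^sub>R w) - F (x + s *\<^sub>R v) - F (x + s *\<^sub>R w) + F x = s * s * P (x + a *\<^sub>R v + b *\<^sub>R w)"
    using second_difference[OF F s inU] unfolding P_def by blast
  have inU': "x + a *\<^sub>R w + b *\<^sub>R v \<in> U" if "0 \<le> a" "a \<le> s" "0 \<le> b" "b \<le> s" for a b
    using inU[OF that(3,4,1,2)] by (simp add: algebra_simps)
  obtain a' b' where ab': "0 < a'" "a' < s" "0 < b'" "b' < s" and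
    Q: "F (x + s *\<^sub>R w + s *\<^sub>R v) - F (x + s *\<^sub>R w) - F (x + s *\<^sub>R v) + F x = s * s * Q (x + a' *\<^sub>R w + b' *\<^sub>R v)"
    using second_difference[OF F s inU'] unfolding Q_def by blast
  have swap: "x + s *\<^sub>R w + s *\<^sub>R v = x + s *\<^sub>R v + s *\<^sub>R w" by (simp add: algebra_simps)
  have "s * s * P (x + a *\<^sub>R v + b *\<^sub>R w) = s * s * Q (x + a' *\<^sub>R w + b' *\<^sub>R v)"
    using P Q unfolding swap by linarith
  then have "P (x + a *\<^sub>R v + b *\<^sub>R w) = Q (x + a' *\<^sub>R w + b' *\<^sub>R v)" using s by simp
  moreover have "dist (P (x + a *\<^sub>R v + b *\<^sub>R w)) (P x) < \<bar>P x - Q x\<bar> / 2"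
    using close[of a b] ab by (intro d1) (auto simp: d_def)
  moreover have "dist (Q (x + a' *\<^sub>R w + b' *\<^sub>R v)) (Q x) < \<bar>P x - Q x\<bar> / 2"
    using close[of b' a'] ab' by (intro d2) (auto simp: d_def algebra_simps)
  ultimately show False unfolding dist_real_def by (smt (verit) field_sum_of_halves)
qed

lemma dirder_commute:
  fixes f :: "'a::real_normed_vector \<Rightarrow> real^'n"
  assumes U: "open U" "x \<in> U" and f: "smooth_on U f"
  shows "dirder (\<lambda>y. dirder f y v) x w = dirder (\<lambda>y. dirder f y w) x v"
proof -
  have "dirder (\<lambda>y. dirder f y v) x w $ i = dirder (\<lambda>y. dirder (\<lambda>z. f z $ i) y v) x w" for v w i
  proof -
    have "dirder (\<lambda>y. dirder f y v) x w $ i = dirder (\<lambda>y. dirder f y v $ i) x w"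
      using U smooth_on_differentiable[OF smooth_on_dirder[OF f]] by (simp add: dirder_vec_nth)
    also have "\<dots> = dirder (\<lambda>y. dirder (\<lambda>z. f z $ i) y v) x w"
      using smooth_on_differentiable[OF f]
      by (intro fun_cong[OF dirder_cong_open[OF U]]) (simp add: dirder_vec_nth)
    finally show ?thesis .
  qed
  then show ?thesis
    using dirder_commute_real[OF U smooth_on_vec_nth[OF U(1) f]] by (simp add: vec_eq_iff)
qed

text \<open>Linearity in Y uses that the first derivative is linear at all points near x, not just
  at x. Both linearities are what the frame formula for the trace asks for.\<close>

lemma linear_dirder_dirder:
  assumes U: "open U" "x \<in> U" and F: "smooth_on U F"
  shows "linear (\<lambda>X. dirder (\<lambda>y. dirder F y Y) x X)" and "linear (\<lambda>Y. dirder (\<lambda>y. dirder F y Y) x X)"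
proof -
  note d = smooth_on_differentiable[OF F] smooth_on_differentiable[OF smooth_on_dirder[OF F] U(2)]
  show "linear (\<lambda>X. dirder (\<lambda>y. dirder F y Y) x X)"
    using d(2) by (rule linear_frechet_derivative)
  show "linear (\<lambda>Y. dirder (\<lambda>y. dirder F y Y) x X)"
  proof (rule linearI)
    fix Y Z
    have "dirder (\<lambda>y. dirder F y (Y + Z)) x X = dirder (\<lambda>y. dirder F y Y + dirder F y Z) x X"
      using d(1) by (intro fun_cong[OF dirder_cong_open[OF U]]) (simp add: linear_add[OF linear_frechet_derivative])
    then show "dirder (\<lambda>y. dirder F y (Y + Z)) x X = dirder (\<lambda>y. dirder F y Y) x X + dirder (\<lambda>y. dirder F y Z) x X"
      by (simp add: dirder_add d(2))
  next
    fix c Y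
    have "dirder (\<lambda>y. dirder F y (c *\<^sub>R Y)) x X = dirder (\<lambda>y. c *\<^sub>R dirder F y Y) x X"
      using d(1) by (intro fun_cong[OF dirder_cong_open[OF U]]) (simp add: linear_cmul[OF linear_frechet_derivative])
    also have "\<dots> = c *\<^sub>R dirder (\<lambda>y. dirder F y Y) x X"
      by (subst dirder_eqI[OF has_derivative_scaleR_right[OF has_derivative_dirder[OF d(2)]]]) simp
    finally show "dirder (\<lambda>y. dirder F y (c *\<^sub>R Y)) x X = c *\<^sub>R dirder (\<lambda>y. dirder F y Y) x X" .
  qed
qed

section \<open>Metrics and traces\<close>

definition positive_metric :: "real^'k^'k \<Rightarrow> bool" where
  "positive_metric G \<longleftrightarrow> transpose G = G \<and> (\<forall>v. v \<noteq> 0 \<longrightarrow> metric_inner G v v > 0)"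

lemma linear_metric_inner: "linear (metric_inner G v)" "linear (\<lambda>v. metric_inner G v w)"
  unfolding metric_inner_def
  by (auto intro!: linearI simp: inner_add_left inner_add_right matrix_vector_right_distrib
      matrix_vector_mult_scaleR)

lemma metric_inner_commute:
  assumes "transpose G = G"
  shows "metric_inner G v w = metric_inner G w v"
proof -
  have "v \<bullet> (G *v w) = (transpose G *v v) \<bullet> w"
    by (simp add: dot_lmul_matrix transpose_matrix_vector)
  then show ?thesis by (simp add: metric_inner_def assms inner_commute)
qed

lemma positive_metric_invertible:
  assumes "positive_metric G"
  shows "invertible G"
proof -
  have "v = 0" if "G *v v = 0" for v
    using assms that unfolding positive_metric_def metric_inner_def by fastforce
  then show ?thesis
    by (simp add: invertible_left_inverse matrix_left_invertible_ker)
qed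

lemma transpose_matrix_inv:
  fixes G :: "real^'k^'k"
  assumes "transpose G = G" "invertible G"
  shows "transpose (matrix_inv G) = matrix_inv G"
proof -
  have "transpose (matrix_inv G) = transpose (matrix_inv G) ** (G ** matrix_inv G)"
    by (simp add: matrix_inv_right[OF assms(2)])
  also have "\<dots> = transpose (G ** matrix_inv G) ** matrix_inv G"
    by (simp add: matrix_mul_assoc matrix_transpose_mul assms(1))
  finally show ?thesis by (simp add: matrix_inv_right[OF assms(2)] transpose_mat)
qed

text \<open>Gram-Schmidt, by induction on a set S of indices. A vector Euclidean-orthogonal to all
  \<open>G *v e i\<close> is orthogonal to all \<open>e i\<close> in the metric G; a nonzero one
  exists as long as S is a proper subset of the index type.\<close>

lemma orthonormal_frame_exists:
  fixes G :: "real^'k^'k"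
  assumes "positive_metric G"
  obtains e :: "'k \<Rightarrow> real^'k" where "\<And>i j. metric_inner G (e i) (e j) = (if i = j then 1 else 0)"
proof -
  have sym: "metric_inner G v w = metric_inner G w v" for v w
    using assms metric_inner_commute by (auto simp: positive_metric_def)
  have "\<exists>e. \<forall>i\<in>S. \<forall>j\<in>S. metric_inner G (e i) (e j) = (if i = j then 1 else 0)" if "finite S" for S :: "'k set"
    using that
  proof (induction S rule: finite_induct)
    case (insert a S)
    then obtain e where e: "\<forall>i\<in>S. \<forall>j\<in>S. metric_inner G (e i) (e j) = (if i = j then 1 else 0)" by blast
    have "card S < CARD('k)"
      using insert(2) by (intro psubset_card_mono) auto
    then have "dim ((\<lambda>i. G *v e i) ` S) < DIM(real^'k)"
      using dim_le_card'[of "(\<lambda>i. G *v e i) ` S"] card_image_le[OF insert(1), of "\<lambda>i. G *v e i"] insert(1)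
      by (simp add: le_less_trans)
    then obtain v where v: "v \<noteq> 0" "\<And>y. y \<in> span ((\<lambda>i. G *v e i) ` S) \<Longrightarrow> orthogonal v y"
      using orthogonal_to_subspace_exists by blast
    define c where "c = 1 / sqrt (metric_inner G v v)"
    have pos: "metric_inner G v v > 0" using assms v by (simp add: positive_metric_def)
    have c: "c * (c * metric_inner G v v) = 1"
      using pos by (simp add: c_def field_simps flip: power2_eq_square)
    have o: "metric_inner G v (e i) = 0" if "i \<in> S" for i
      using v(2)[of "G *v e i"] that by (simp add: orthogonal_def metric_inner_def span_base)
    then have o': "metric_inner G (e i) v = 0" if "i \<in> S" for i
      using that sym[of "e i" v] by simp
    have cv: "metric_inner G (c *\<^sub>R v) w = c * metric_inner G v w"
      "metric_inner G w (c *\<^sub>R v) = c * metric_inner G w v" for w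
      by (simp_all add: metric_inner_def matrix_vector_mult_scaleR)
    show ?case
    proof (intro exI[of _ "e(a := c *\<^sub>R v)"] ballI)
      fix i j assume "i \<in> insert a S" "j \<in> insert a S"
      then show "metric_inner G ((e(a := c *\<^sub>R v)) i) ((e(a := c *\<^sub>R v)) j) = (if i = j then 1 else 0)"
        using e o o' insert(2) c by (auto simp: cv)
    qed
  qed auto
  from this[of UNIV] show thesis using that by auto
qed

text \<open>The sum over the entries of \<open>matrix_inv G\<close> shows no sign; in an orthonormal
  frame only diagonal values of b remain.\<close>

lemma metric_trace_nonpos:
  fixes b :: "real^'k \<Rightarrow> real^'k \<Rightarrow> real"
  assumes "positive_metric G" "\<And>v. linear (\<lambda>w. b v w)" "\<And>w. linear (\<lambda>v. b v w)" "\<And>v. b v v \<le> 0"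
  shows "metric_trace G b \<le> 0"
proof -
  obtain e :: "'k \<Rightarrow> real^'k" where "\<And>i j. metric_inner G (e i) (e j) = (if i = j then 1 else 0)"
    using orthonormal_frame_exists[OF assms(1)] by blast
  from metric_trace_orthonormal[OF this assms(2,3)] show ?thesis
    using assms(4) by (simp add: sum_nonpos)
qed

lemma metric_trace_add: "metric_trace G (\<lambda>X Y. b X Y + c X Y) = metric_trace G b + metric_trace G c"
  by (simp add: metric_trace_def sum.distrib scaleR_add_right)

lemma metric_trace_linear:
  "linear L \<Longrightarrow> L (metric_trace G b) = metric_trace G (\<lambda>X Y. L (b X Y))"
  by (simp add: metric_trace_def linear_sum linear_cmul)

lemma metric_trace_cmult:
  fixes b :: "real^'k \<Rightarrow> real^'k \<Rightarrow> real"
  shows "metric_trace G (\<lambda>X Y. c * b X Y) = c * metric_trace G b"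
  by (simp add: metric_trace_def sum_distrib_left mult_ac)

section \<open>The strong maximum principle\<close>

text \<open>Otherwise the derivative along the line through x in direction v, zero at x, would
  become positive just beyond x, and the mean value theorem would produce a value above the
  maximum.\<close>

lemma second_derivative_local_max:
  fixes F :: "'a::real_normed_vector \<Rightarrow> real"
  assumes U: "open U" "x \<in> U" and F: "smooth_on U F" and max: "\<And>y. y \<in> U \<Longrightarrow> F y \<le> F x"
  shows "dirder F x v = 0" and "dirder (\<lambda>y. dirder F y v) x v \<le> 0"
proof -
  note d = smooth_on_differentiable[OF F] smooth_on_differentiable[OF smooth_on_dirder[OF F]]
  show z: "dirder F x v = 0"
    using differential_zero_maxmin[OF U(2,1) has_derivative_dirder[OF d(1)[OF U(2)]]] max by metis
  show "dirder (\<lambda>y. dirder F y v) x v \<le> 0"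
  proof (rule ccontr)
    assume "\<not> ?thesis"
    then have pos: "dirder (\<lambda>y. dirder F y v) (x + 0 *\<^sub>R v) v > 0" by simp
    have "((\<lambda>t. dirder F (x + t *\<^sub>R v) v) has_real_derivative
        dirder (\<lambda>y. dirder F y v) (x + 0 *\<^sub>R v) v) (at 0)"
      using U by (intro has_real_derivative_along_line d) simp
    from DERIV_pos_inc_right[OF this pos] obtain d1
      where d1: "d1 > 0" "\<And>h. 0 < h \<Longrightarrow> h < d1 \<Longrightarrow> 0 < dirder F (x + h *\<^sub>R v) v"
      using z by auto
    have "open ((\<lambda>t. x + t *\<^sub>R v) -` U)"
      by (intro continuous_open_vimage U continuous_intros)
    then obtain d2 where d2: "d2 > 0" "ball 0 d2 \<subseteq> (\<lambda>t. x + t *\<^sub>R v) -` U"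
      using U(2) open_contains_ball[of "(\<lambda>t. x + t *\<^sub>R v) -` U"] by force
    define h where "h = min d1 d2 / 2"
    have h: "0 < h" "h < d1" "h < d2" using d1 d2 by (auto simp: h_def)
    have inU: "x + t *\<^sub>R v \<in> U" if "0 \<le> t" "t \<le> h" for t
      using d2(2) h that by (auto simp: subset_iff)
    have "((\<lambda>t. F (x + t *\<^sub>R v)) has_real_derivative dirder F (x + t *\<^sub>R v) v) (at t)"
      if "0 \<le> t" "t \<le> h" for t
      using inU[OF that] by (intro has_real_derivative_along_line d)
    from MVT2[OF h(1) this] obtain t where t: "0 < t" "t < h"
      "F (x + h *\<^sub>R v) - F (x + 0 *\<^sub>R v) = (h - 0) * dirder F (x + t *\<^sub>R v) v" by blast
    have "0 < h * dirder F (x + t *\<^sub>R v) v"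
      using h t d1(2)[of t] by simp
    then have "F (x + h *\<^sub>R v) > F x" using t(3) by simp
    then show False using max[OF inU[of h]] h by simp
  qed
qed

text \<open>A second-order operator without zeroth-order term: leading coefficients
  \<open>matrix_inv G\<close>, drift \<open>\<beta>\<close>. If the drift is minus the trace of
  \<open>conn_form G\<close>, it is the Laplace-Beltrami operator of G.\<close>

definition elliptic_op ::
    "(real^'m \<Rightarrow> real^'m^'m) \<Rightarrow> (real^'m \<Rightarrow> real^'m) \<Rightarrow> (real^'m \<Rightarrow> real) \<Rightarrow> real^'m \<Rightarrow> real" where
  "elliptic_op G \<beta> f x = metric_trace (G x) (\<lambda>X Y. dirder (\<lambda>y. dirder f y Y) x X) + dirder f x (\<beta> x)"

lemma elliptic_op_local_max:
  assumes "open U" "x \<in> U" "smooth_on U F" "\<And>y. y \<in> U \<Longrightarrow> F y \<le> F x" "positive_metric (G x)"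
  shows "elliptic_op G \<beta> F x \<le> 0"
  unfolding elliptic_op_def
  using second_derivative_local_max[OF assms(1-4)]
    metric_trace_nonpos[OF assms(5) linear_dirder_dirder(2,1)[OF assms(1-3)]] by simp

lemma elliptic_op_add_cmult:
  assumes U: "open U" "x \<in> U" and f: "smooth_on U f" and g: "smooth_on U g"
  shows "elliptic_op G \<beta> (\<lambda>y. f y + c * g y) x = elliptic_op G \<beta> f x + c * elliptic_op G \<beta> g x"
proof -
  note d = smooth_on_differentiable[OF f] smooth_on_differentiable[OF g]
    smooth_on_differentiable[OF smooth_on_dirder[OF f]] smooth_on_differentiable[OF smooth_on_dirder[OF g]]
  have cd: "(\<lambda>y. c * h y) differentiable (at y)" if "h differentiable (at y)" for h :: "real^'a \<Rightarrow> real" and y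
    using that by (intro differentiable_mult) auto
  have 1: "dirder (\<lambda>y. f y + c * g y) y v = dirder f y v + c * dirder g y v" if "y \<in> U" for y v
    by (simp add: dirder_add dirder_cmult d[OF that] cd)
  have "dirder (\<lambda>y. dirder (\<lambda>y. f y + c * g y) y Y) x X
      = dirder (\<lambda>y. dirder f y Y + c * dirder g y Y) x X" for X Y
    by (intro fun_cong[OF dirder_cong_open[OF U]] 1)
  then have "dirder (\<lambda>y. dirder (\<lambda>y. f y + c * g y) y Y) x X
      = dirder (\<lambda>y. dirder f y Y) x X + c * dirder (\<lambda>y. dirder g y Y) x X" for X Y
    by (simp add: dirder_add dirder_cmult d[OF U(2)] cd)
  then show ?thesis
    by (simp add: elliptic_op_def 1[OF U(2)] metric_trace_add metric_trace_cmult algebra_simps)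
qed

section \<open>Hopf's barrier and the touching ball\<close>

text \<open>In the bracket \<alpha> multiplies the first trace only, and for a positive metric that
  trace is positive where x differs from c. A large \<alpha> therefore makes the operator positive
  on h near a given point other than c.\<close>

lemma elliptic_op_barrier:
  fixes c :: "real^'m" and \<alpha> :: real
  defines "h \<equiv> \<lambda>x. exp (- \<alpha> * ((x - c) \<bullet> (x - c)))"
  shows "elliptic_op G \<beta> h x = 2 * \<alpha> * h x *
    (2 * \<alpha> * metric_trace (G x) (\<lambda>X Y. ((x - c) \<bullet> X) * ((x - c) \<bullet> Y))
      - metric_trace (G x) (\<lambda>X Y. X \<bullet> Y) - (x - c) \<bullet> \<beta> x)"
proof -
  have h: "(h has_derivative (\<lambda>v. - 2 * \<alpha> * ((y - c) \<bullet> v) * h y)) (at y)" for y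
    unfolding h_def by (auto intro!: derivative_eq_intros simp: algebra_simps inner_commute)
  have h': "((\<lambda>y. - 2 * \<alpha> * ((y - c) \<bullet> Y) * h y) has_derivative
      (\<lambda>X. 2 * \<alpha> * h y * (2 * \<alpha> * (((y - c) \<bullet> X) * ((y - c) \<bullet> Y)) - X \<bullet> Y))) (at y)" for y Y
    by (auto intro!: derivative_eq_intros h simp: algebra_simps)
  have d2: "dirder (\<lambda>y. dirder h y Y) x X
      = 2 * \<alpha> * h x * (2 * \<alpha> * (((x - c) \<bullet> X) * ((x - c) \<bullet> Y)) + (- 1) * (X \<bullet> Y))" for X Y
    using fun_cong[OF dirder_eqI[OF h'], of Y x X] by (simp add: dirder_eqI[OF h])
  show ?thesis
    unfolding elliptic_op_def d2 metric_trace_cmult metric_trace_add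
    by (simp add: dirder_eqI[OF h] algebra_simps)
qed

text \<open>The trace is the squared length of the covector w, which is that of the vector z
  obtained by raising its index.\<close>

lemma metric_trace_square_pos:
  fixes w :: "real^'m"
  assumes "positive_metric G" "w \<noteq> 0"
  shows "metric_trace G (\<lambda>X Y. (w \<bullet> X) * (w \<bullet> Y)) > 0"
proof -
  note inv = positive_metric_invertible[OF assms(1)]
  define z where "z = matrix_inv G *v w"
  have w: "G *v z = w" by (simp add: z_def matrix_vector_mul_assoc matrix_inv_right[OF inv])
  then have "z \<noteq> 0" using assms(2) by auto
  have "metric_trace G (\<lambda>X Y. (w \<bullet> X) * (w \<bullet> Y))
      = (\<Sum>i\<in>UNIV. w $ i * (\<Sum>j\<in>UNIV. matrix_inv G $ i $ j * w $ j))"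
    by (simp add: metric_trace_def inner_axis sum_distrib_left mult_ac)
  also have "\<dots> = w \<bullet> z"
    by (simp add: z_def inner_vec_def matrix_vector_mult_def)
  also have "\<dots> = metric_inner G z z" using w by (simp add: metric_inner_def inner_commute)
  finally show ?thesis using assms(1) \<open>z \<noteq> 0\<close> by (simp add: positive_metric_def)
qed

text \<open>The triangle inequality gives at most twice the norm of d; strictness is the point. It
  places a closed ball of half the radius, internally tangent at one point, inside the open ball
  apart from that point.\<close>

lemma norm_add_less_double:
  fixes z d :: "'a::real_inner"
  assumes "norm z \<le> norm d" "z \<noteq> d"
  shows "norm (z + d) < 2 * norm d"
proof -
  have "(z - d) \<bullet> (z - d) > 0" using assms(2) by simp
  then have "2 * (z \<bullet> d) < z \<bullet> z + d \<bullet> d"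
    by (simp add: inner_diff_left inner_diff_right inner_commute)
  moreover have "z \<bullet> z \<le> d \<bullet> d"
    using assms(1) by (simp add: norm_le)
  ultimately have "(z + d) \<bullet> (z + d) < (2 *\<^sub>R d) \<bullet> (2 *\<^sub>R d)"
    by (simp add: inner_add_left inner_add_right inner_commute)
  then have "norm (z + d) < norm (2 *\<^sub>R d)" by (simp only: norm_lt)
  then show ?thesis by simp
qed

text \<open>Take q off the set where r = K, close to a point of the set that is not interior to it.
  The open ball around q reaching up to the nearest point p of the set avoids the set, but its
  boundary may meet the set elsewhere. The closed ball with diameter from q to p meets it at p
  only.\<close>

lemma interior_sphere_touching:
  fixes r :: "'a::euclidean_space \<Rightarrow> real"
  assumes W: "open W" and r: "continuous_on W r" and le: "\<And>x. x \<in> W \<Longrightarrow> r x \<le> K"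
    and nopen: "\<not> open {x \<in> W. r x = K}"
  obtains c p where "p \<in> W" "r p = K" "c \<noteq> p"
    "\<And>y. dist c y \<le> dist c p \<Longrightarrow> y \<noteq> p \<Longrightarrow> y \<in> W \<and> r y < K"
proof -
  obtain x0 where x0: "x0 \<in> W" "r x0 = K" and no: "\<And>e. e > 0 \<Longrightarrow> \<not> ball x0 e \<subseteq> {x \<in> W. r x = K}"
    using nopen unfolding open_contains_ball by auto
  obtain s0 where s0: "s0 > 0" "cball x0 s0 \<subseteq> W" using W x0 open_contains_cball by blast
  \<comment> \<open>The factor two gives room: q is within s of the centre and the ball around q has
    radius below s, so all of that ball stays in \<open>cball x0 (2 * s)\<close>.\<close>
  define s where "s = s0 / 2"
  have s: "s > 0" "cball x0 (2 * s) \<subseteq> W" using s0 by (auto simp: s_def)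
  obtain q where q: "q \<in> ball x0 s" "q \<notin> {x \<in> W. r x = K}" using no[OF s(1)] by blast
  define Z where "Z = {x \<in> cball x0 (2 * s). r x = K}"
  have "closed Z"
    using continuous_closed_preimage_constant[OF continuous_on_subset[OF r s(2)]] by (simp add: Z_def)
  moreover have "x0 \<in> Z" using s x0 by (simp add: Z_def)
  ultimately obtain p where p: "p \<in> Z" "\<And>y. y \<in> Z \<Longrightarrow> dist q p \<le> dist q y"
    using distance_attains_inf[of Z q] by blast
  have "dist q p < s" using p(2)[OF \<open>x0 \<in> Z\<close>] q(1) by (simp add: dist_commute)
  have near: "y \<in> W \<and> r y < K" if "dist q y < dist q p" for y
  proof -
    have "dist x0 y \<le> dist x0 q + dist q y" by (rule dist_triangle)
    then have y: "y \<in> cball x0 (2 * s)" using q(1) that \<open>dist q p < s\<close> by simp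
    moreover have "y \<notin> Z" using p(2)[of y] that by auto
    ultimately have "y \<in> W" "r y \<noteq> K" using s by (auto simp: Z_def)
    then show ?thesis using le[of y] by simp
  qed
  have "q \<noteq> p" using p(1) q s unfolding Z_def by blast
  define c where "c = (1/2) *\<^sub>R (q + p)"
  define d where "d = (1/2) *\<^sub>R (p - q)"
  have qd: "q = c - d" and pd: "p = c + d"
    by (simp_all add: c_def d_def algebra_simps flip: scaleR_add_left)
  have qp: "dist q p = 2 * norm d" by (simp add: d_def dist_norm norm_minus_commute)
  show thesis
  proof (rule that)
    show "p \<in> W" "r p = K" using p(1) s by (auto simp: Z_def)
    show "c \<noteq> p" using \<open>q \<noteq> p\<close> qd pd by auto
    fix y assume y: "dist c y \<le> dist c p" "y \<noteq> p"
    have "norm ((y - c) + d) < 2 * norm d"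
      using y by (intro norm_add_less_double) (auto simp: pd dist_norm norm_minus_commute)
    then have "dist q y < dist q p"
      unfolding qp by (simp add: qd dist_norm norm_minus_commute algebra_simps)
    then show "y \<in> W \<and> r y < K" by (rule near)
  qed
qed

text \<open>
  Hopf's barrier \<open>h\<close>: adding a small multiple of it to \<open>r\<close> produces a maximum in the interior of a ball
  around the touching point, where the operator is positive.
\<close>

lemma strong_maximum_principle:
  fixes r :: "real^'m \<Rightarrow> real"
  assumes W: "open W" and r: "smooth_on W r" and G: "\<And>x. x \<in> W \<Longrightarrow> positive_metric (G x)"
    and Gc: "continuous_on W (\<lambda>x. matrix_inv (G x))" and \<beta>: "continuous_on W \<beta>"
    and L: "\<And>x. x \<in> W \<Longrightarrow> elliptic_op G \<beta> r x \<ge> 0" and le: "\<And>x. x \<in> W \<Longrightarrow> r x \<le> K"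
  shows "open {x \<in> W. r x = K}"
proof (rule ccontr)
  assume "\<not> ?thesis"
  then obtain c p where p: "p \<in> W" "r p = K" "c \<noteq> p"
    and touch: "\<And>y. dist c y \<le> dist c p \<Longrightarrow> y \<noteq> p \<Longrightarrow> y \<in> W \<and> r y < K"
    using interior_sphere_touching[OF W smooth_on_continuous[OF r] le] by metis
  define A where "A x = metric_trace (G x) (\<lambda>X Y. ((x - c) \<bullet> X) * ((x - c) \<bullet> Y))" for x
  define B where "B x = metric_trace (G x) (\<lambda>X Y. X \<bullet> Y) + (x - c) \<bullet> \<beta> x" for x
  have "A p > 0" using metric_trace_square_pos[OF G[OF p(1)]] p(3) by (simp add: A_def)
  \<comment> \<open>Makes \<open>2 * \<alpha> * A p\<close> equal to
    \<open>2 * (\<bar>B p\<bar> + 1)\<close>, which exceeds \<open>B p\<close>.\<close>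
  define \<alpha> where "\<alpha> = (\<bar>B p\<bar> + 1) / A p"
  have \<alpha>: "\<alpha> > 0" using \<open>A p > 0\<close> by (simp add: \<alpha>_def)
  define k where "k x = 2 * \<alpha> * A x - B x" for x
  have "k p > 0" using \<open>A p > 0\<close> by (simp add: k_def \<alpha>_def)
  have "continuous_on W k"
    unfolding k_def A_def B_def metric_trace_def
    by (intro continuous_intros continuous_on_component Gc \<beta>)
  then have "open (W \<inter> k -` {0<..})"
    by (rule continuous_open_preimage[OF _ W open_greaterThan])
  moreover have "p \<in> W \<inter> k -` {0<..}" using p \<open>k p > 0\<close> by simp
  ultimately obtain \<epsilon> where \<epsilon>: "\<epsilon> > 0" "cball p \<epsilon> \<subseteq> W \<inter> k -` {0<..}"
    using open_contains_cball by blast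
  have eW: "cball p \<epsilon> \<subseteq> W" and ek: "\<And>x. x \<in> cball p \<epsilon> \<Longrightarrow> k x > 0" using \<epsilon> by auto
  define h where "h x = exp (- \<alpha> * ((x - c) \<bullet> (x - c)))" for x
  have h1: "h x \<le> 1" "h x > 0" for x using \<alpha> by (simp_all add: h_def)
  have hlt: "h x < h p" if "dist c x > dist c p" for x
  proof -
    have "norm (p - c) < norm (x - c)" using that by (simp add: dist_norm norm_minus_commute)
    then show ?thesis using \<alpha> by (simp add: h_def norm_lt)
  qed
  have sh: "smooth_on W h"
  proof -
    have "smooth_on W (\<lambda>x. x - c)"
      using smooth_on_add[OF W smooth_on_id smooth_on_const[of W "- c"]] by simp
    then show ?thesis unfolding h_def
      by (intro smooth_on_exp smooth_on_mult smooth_on_inner smooth_on_const W)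
  qed
  have Lh: "elliptic_op G \<beta> h x > 0" if "x \<in> cball p \<epsilon>" for x
  proof -
    have "elliptic_op G \<beta> h x = 2 * \<alpha> * h x * k x"
      unfolding h_def elliptic_op_barrier k_def A_def B_def by (simp only: diff_diff_add)
    then show ?thesis using ek[OF that] \<alpha> h1(2)[of x] by simp
  qed
  \<comment> \<open>On the part of the small sphere inside the touching ball, r stays below K by a
    fixed amount, because that part is compact and misses p. If it is empty, any M below K will
    do.\<close>
  obtain M where M: "M < K" "\<And>y. y \<in> sphere p \<epsilon> \<inter> cball c (dist c p) \<Longrightarrow> r y \<le> M"
  proof (cases "sphere p \<epsilon> \<inter> cball c (dist c p) = {}")
    case True
    then show thesis using that[of "K - 1"] by auto
  next
    case False
    have "continuous_on (sphere p \<epsilon> \<inter> cball c (dist c p)) r"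
      using eW by (intro continuous_on_subset[OF smooth_on_continuous[OF r]]) auto
    then obtain z where z: "z \<in> sphere p \<epsilon> \<inter> cball c (dist c p)"
      "\<And>y. y \<in> sphere p \<epsilon> \<inter> cball c (dist c p) \<Longrightarrow> r y \<le> r z"
      using continuous_attains_sup[of "sphere p \<epsilon> \<inter> cball c (dist c p)" r] False
      by (metis compact_Int_closed compact_sphere closed_cball)
    have "r z < K" using touch[of z] z(1) \<epsilon>(1) by auto
    then show thesis using that[of "r z"] z by blast
  qed
  \<comment> \<open>Half the gap: inside the touching ball
    \<open>F y \<le> M + \<delta> < K < F p\<close>, because \<open>0 < h \<le> 1\<close>. Outside
    it h is strictly smaller than at p, while \<open>r \<le> K = r p\<close>.\<close>
  define \<delta> where "\<delta> = (K - M) / 2"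
  have \<delta>: "\<delta> > 0" using M by (simp add: \<delta>_def)
  define F where "F x = r x + \<delta> * h x" for x
  have bd: "F y < F p" if "y \<in> sphere p \<epsilon>" for y
  proof (cases "dist c y \<le> dist c p")
    case True
    then have "r y \<le> M" using M that by simp
    moreover have "\<delta> * h y \<le> \<delta>" "\<delta> * h p > 0" using h1[of y] h1[of p] \<delta> by simp_all
    moreover have "M + \<delta> < K" using M(1) by (simp add: \<delta>_def field_simps)
    ultimately show ?thesis unfolding F_def p(2) by linarith
  next
    case False
    then have "\<delta> * h y < \<delta> * h p" using hlt \<delta> by simp
    moreover have "r y \<le> K" using le eW that by auto
    ultimately show ?thesis using p(2) by (simp add: F_def)
  qed
  have sF: "smooth_on W F"
    unfolding F_def using smooth_on_add[OF W r smooth_on_mult[OF W smooth_on_const sh]] .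
  have "continuous_on (cball p \<epsilon>) F"
    using smooth_on_continuous[OF sF] eW by (rule continuous_on_subset)
  then obtain y where y: "y \<in> cball p \<epsilon>" "\<And>z. z \<in> cball p \<epsilon> \<Longrightarrow> F z \<le> F y"
    using continuous_attains_sup[of "cball p \<epsilon>" F] \<epsilon>(1) by (metis compact_cball cball_eq_empty not_less_iff_gr_or_eq)
  have "F p \<le> F y" using y(2)[of p] \<epsilon>(1) by simp
  then have "y \<notin> sphere p \<epsilon>" using bd[of y] by auto
  then have yb: "y \<in> ball p \<epsilon>" using y(1) by auto
  \<comment> \<open>The maximum of F lies in the open ball, so the operator is nonpositive on F
    there; but it is nonnegative on r and positive on h.\<close>
  have "elliptic_op G \<beta> F y \<le> 0"
    using yb y eW by (intro elliptic_op_local_max[of "ball p \<epsilon>"] smooth_on_subset[OF sF] G) auto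
  moreover have "elliptic_op G \<beta> F y = elliptic_op G \<beta> r y + \<delta> * elliptic_op G \<beta> h y"
    unfolding F_def using y(1) eW by (intro elliptic_op_add_cmult[OF W _ r sh]) auto
  moreover have "\<delta> * elliptic_op G \<beta> h y > 0" using Lh[OF y(1)] \<delta> by simp
  moreover have "elliptic_op G \<beta> r y \<ge> 0" using L y(1) eW by auto
  ultimately show False by linarith
qed

section \<open>Tensor calculus in local coordinates\<close>

lemma differentiable_vecI:
  fixes f :: "'a::real_normed_vector \<Rightarrow> real^'n"
  assumes "\<And>i. (\<lambda>x. f x $ i) differentiable (at x)"
  shows "f differentiable (at x)"
proof -
  have "(\<lambda>x. \<Sum>i\<in>UNIV. f x $ i *\<^sub>R axis i 1 :: real^'n) differentiable (at x)"
    using assms by (intro differentiable_sum) auto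
  moreover have "(\<Sum>i\<in>UNIV. f x $ i *\<^sub>R axis i 1) = f x" for x
    using basis_expansion[of "f x"] by (simp add: scalar_mult_eq_scaleR)
  ultimately show ?thesis by (simp only:)
qed

lemma differentiable_prod:
  fixes f :: "'i \<Rightarrow> 'a::real_normed_vector \<Rightarrow> real"
  assumes "\<And>i. i \<in> I \<Longrightarrow> f i differentiable (at x)"
  shows "(\<lambda>x. \<Prod>i\<in>I. f i x) differentiable (at x)"
  using assms by (induction I rule: infinite_finite_induct) auto

lemma differentiable_det:
  fixes M :: "'a::real_normed_vector \<Rightarrow> real^'k^'k"
  assumes "\<And>i j. (\<lambda>x. M x $ i $ j) differentiable (at x)"
  shows "(\<lambda>x. det (M x)) differentiable (at x)"
  unfolding det_def
  by (intro differentiable_sum ballI differentiable_mult differentiable_const differentiable_prod assms) simp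

text \<open>Cramer's rule presents each entry of the inverse as a quotient of determinants, which
  are polynomials in matrix entries. Invertibility on all of U makes this formula valid near
  x.\<close>

lemma differentiable_matrix_inv:
  fixes M :: "'a::real_normed_vector \<Rightarrow> real^'k^'k"
  assumes U: "open U" "x \<in> U" and inv: "\<And>y. y \<in> U \<Longrightarrow> invertible (M y)"
    and M: "\<And>i j. (\<lambda>x. M x $ i $ j) differentiable (at x)"
  shows "(\<lambda>x. matrix_inv (M x) $ i $ j) differentiable (at x)"
proof (rule differentiable_cong_open[OF _ U])
  let ?D = "\<lambda>y. det (\<chi> a b. if b = i then axis j 1 $ a else M y $ a $ b)"
  show "(\<lambda>y. ?D y / det (M y)) differentiable (at x)"
    using inv[OF U(2)]
  proof (intro differentiable_divide differentiable_det M)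
    show "(\<lambda>y. (\<chi> a b. if b = i then axis j 1 $ a else M y $ a $ b) $ a $ b) differentiable (at x)" for a b
      by (cases "b = i") (simp_all add: M)
  qed (simp add: invertible_det_nz)
  show "?D y / det (M y) = matrix_inv (M y) $ i $ j" if "y \<in> U" for y
  proof -
    have "M y *v (matrix_inv (M y) *v axis j 1) = axis j 1"
      by (simp add: matrix_vector_mul_assoc matrix_inv_right[OF inv[OF that]])
    then have "matrix_inv (M y) *v axis j 1
        = (\<chi> k. det (\<chi> a b. if b = k then axis j 1 $ a else M y $ a $ b) / det (M y))"
      using inv[OF that] cramer[of "M y"] by (simp add: invertible_det_nz)
    then have "(matrix_inv (M y) *v axis j 1) $ i = ?D y / det (M y)" by simp
    then show ?thesis by (simp add: matrix_vector_mult_basis column_def)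
  qed
qed

lemma metric_inner_sum: "metric_inner G v w = (\<Sum>k\<in>UNIV. \<Sum>l\<in>UNIV. v $ k * G $ k $ l * w $ l)"
  by (simp add: metric_inner_def inner_vec_def matrix_vector_mult_def sum_distrib_left mult.assoc)

lemma metric_inner_scaleR: "metric_inner (c *\<^sub>R G) v w = c * metric_inner G v w"
  by (simp add: metric_inner_sum sum_distrib_left mult_ac)

lemma metric_inner_axis: "metric_inner G (axis i 1) (axis j 1) = G $ i $ j"
  by (simp add: metric_inner_def inner_axis' matrix_vector_mult_basis column_def)

lemma positive_metric_transpose: "positive_metric G \<Longrightarrow> transpose G = G"
  by (simp add: positive_metric_def)

lemma positive_metric_scaleR: "positive_metric G \<Longrightarrow> c > 0 \<Longrightarrow> positive_metric (c *\<^sub>R G)"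
  by (simp add: positive_metric_def metric_inner_scaleR transpose_def vec_eq_iff)

lemma matrix_inv_scaleR:
  fixes G :: "real^'k^'k"
  assumes "invertible G" "c \<noteq> 0"
  shows "matrix_inv (c *\<^sub>R G) = (1 / c) *\<^sub>R matrix_inv G"
proof -
  have "(c *\<^sub>R G) ** ((1 / c) *\<^sub>R matrix_inv G) = G ** matrix_inv G"
    using assms(2) by (simp add: vec_eq_iff matrix_matrix_mult_def)
  then have 1: "(c *\<^sub>R G) ** ((1 / c) *\<^sub>R matrix_inv G) = mat 1"
    by (simp add: matrix_inv_right[OF assms(1)])
  then have "invertible (c *\<^sub>R G)"
    using matrix_left_right_inverse invertible_def by blast
  then have "matrix_inv (c *\<^sub>R G) ** ((c *\<^sub>R G) ** ((1 / c) *\<^sub>R matrix_inv G)) = (1 / c) *\<^sub>R matrix_inv G"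
    by (simp add: matrix_mul_assoc matrix_inv_left)
  then show ?thesis by (simp add: 1)
qed

lemma metric_trace_scaleR:
  assumes "invertible G" "c \<noteq> 0"
  shows "metric_trace (c *\<^sub>R G) b = (1 / c) *\<^sub>R metric_trace G b"
  by (simp add: metric_trace_def matrix_inv_scaleR[OF assms] scaleR_sum_right)

lemma metric_trace_swap:
  assumes "positive_metric G"
  shows "metric_trace G (\<lambda>X Y. b Y X) = metric_trace G b"
proof -
  have "matrix_inv G $ i $ j = matrix_inv G $ j $ i" for i j
  proof -
    have "transpose (matrix_inv G) = matrix_inv G"
      using assms by (intro transpose_matrix_inv positive_metric_invertible positive_metric_transpose)
    then have "transpose (matrix_inv G) $ i $ j = matrix_inv G $ i $ j" by simp
    then show ?thesis by (simp add: transpose_def)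
  qed
  then show ?thesis
    unfolding metric_trace_def by (subst sum.swap) simp
qed

text \<open>The covector \<open>metric_inner G _ Z\<close> is Z with its index lowered, and the
  trace raises the index again. The tangential part of the Hessian contains one term of each of the
  two mirrored kinds.\<close>

lemma metric_trace_contract:
  fixes l :: "real^'k \<Rightarrow> real"
  assumes G: "positive_metric G" and l: "linear l"
  shows "metric_trace G (\<lambda>X Y. metric_inner G Y Z * l X) = l Z"
    and "metric_trace G (\<lambda>X Y. metric_inner G X Z * l Y) = l Z"
proof -
  have "metric_trace G (\<lambda>X Y. metric_inner G Y Z * l X)
      = (\<Sum>i\<in>UNIV. (\<Sum>j\<in>UNIV. matrix_inv G $ i $ j * (G *v Z) $ j) * l (axis i 1))"
    by (simp add: metric_trace_def metric_inner_def inner_axis' sum_distrib_right mult.assoc)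
  also have "\<dots> = (\<Sum>i\<in>UNIV. (matrix_inv G *v (G *v Z)) $ i * l (axis i 1))"
    by (subst (2) matrix_vector_mult_def) simp
  also have "\<dots> = (\<Sum>i\<in>UNIV. Z $ i * l (axis i 1))"
    by (simp add: matrix_vector_mul_assoc matrix_inv_left[OF positive_metric_invertible[OF G]])
  also have "\<dots> = l (\<Sum>i\<in>UNIV. Z $ i *\<^sub>R axis i 1)"
    by (simp add: linear_sum[OF l] linear_cmul[OF l])
  also have "\<dots> = l Z"
    using basis_expansion[of Z] by (simp add: scalar_mult_eq_scaleR)
  finally show 1: "metric_trace G (\<lambda>X Y. metric_inner G Y Z * l X) = l Z" .
  show "metric_trace G (\<lambda>X Y. metric_inner G X Z * l Y) = l Z"
    using metric_trace_swap[OF G, of "\<lambda>X Y. metric_inner G Y Z * l X"] 1 by simp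
qed

lemma metric_trace_metric:
  fixes G :: "real^'k^'k"
  assumes G: "positive_metric G"
  shows "metric_trace G (metric_inner G) = real CARD('k)"
proof -
  obtain e :: "'k \<Rightarrow> real^'k" where "\<And>i j. metric_inner G (e i) (e j) = (if i = j then 1 else 0)"
    using orthonormal_frame_exists[OF G] by blast
  with metric_trace_orthonormal[OF this linear_metric_inner(1,2)] show ?thesis by simp
qed

section \<open>The Levi-Civita connection and its pull-back\<close>

lemma conn_form_commute:
  assumes "open S" "x \<in> S" "\<And>y. y \<in> S \<Longrightarrow> positive_metric (G y)"
  shows "conn_form G x X Y = conn_form G x Y X"
proof -
  have "christoffel G x k i j = christoffel G x k j i" for k i j
    using assms
    by (intro christoffel_levi_civita(1)[OF assms(1,2)])
      (auto intro: positive_metric_invertible positive_metric_transpose)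
  then show ?thesis
    unfolding conn_form_def vec_eq_iff
    by (simp, subst sum.swap) (simp add: mult_ac)
qed

text \<open>Metric compatibility of the connection, which \<open>christoffel_levi_civita\<close>
  provides for coordinate vectors, contracted with X, v and w.\<close>

lemma metric_derivative:
  fixes G :: "real^'k \<Rightarrow> real^'k^'k"
  assumes S: "open S" "x \<in> S" "\<And>y. y \<in> S \<Longrightarrow> positive_metric (G y)"
    and d: "\<And>k l. (\<lambda>y. G y $ k $ l) differentiable (at x)"
  shows "(\<Sum>k\<in>UNIV. \<Sum>l\<in>UNIV. v $ k * dirder (\<lambda>y. G y $ k $ l) x X * w $ l)
    = metric_inner (G x) (conn_form G x X v) w + metric_inner (G x) v (conn_form G x X w)"
proof -
  have lc: "dirder (\<lambda>y. G y $ j $ l) x (axis i 1) =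
      (\<Sum>k\<in>UNIV. G x $ k $ l * christoffel G x k i j) + (\<Sum>k\<in>UNIV. G x $ j $ k * christoffel G x k i l)" for i j l
    using S
    by (intro christoffel_levi_civita(2)[OF S(1,2)])
      (auto intro: positive_metric_invertible positive_metric_transpose)
  have D: "dirder (\<lambda>y. G y $ j $ l) x X = (\<Sum>i\<in>UNIV. X $ i * dirder (\<lambda>y. G y $ j $ l) x (axis i 1))" for j l
  proof -
    have "X = (\<Sum>i\<in>UNIV. X $ i *\<^sub>R axis i 1)"
      using basis_expansion[of X] by (simp add: scalar_mult_eq_scaleR)
    then have "dirder (\<lambda>y. G y $ j $ l) x X = dirder (\<lambda>y. G y $ j $ l) x (\<Sum>i\<in>UNIV. X $ i *\<^sub>R axis i 1)"
      by simp
    then show ?thesis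
      by (simp add: linear_sum[OF linear_frechet_derivative[OF d]] linear_cmul[OF linear_frechet_derivative[OF d]])
  qed
  \<comment> \<open>Exchanges the outermost and the innermost of four sums: in
    \<open>metric_inner\<close> the index contracted with G comes first, whereas the expansion of
    the derivative leaves it last.\<close>
  have swap1: "(\<Sum>a\<in>UNIV. \<Sum>b\<in>UNIV. \<Sum>c\<in>UNIV. \<Sum>d\<in>UNIV. t a b c d)
      = (\<Sum>d\<in>UNIV. \<Sum>b\<in>UNIV. \<Sum>c\<in>UNIV. \<Sum>a\<in>UNIV. t a b c d)" for t :: "'k \<Rightarrow> 'k \<Rightarrow> 'k \<Rightarrow> 'k \<Rightarrow> real"
  proof -
    have "(\<Sum>a\<in>UNIV. \<Sum>b\<in>UNIV. \<Sum>c\<in>UNIV. \<Sum>d\<in>UNIV. t a b c d)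
        = (\<Sum>a\<in>UNIV. \<Sum>b\<in>UNIV. \<Sum>d\<in>UNIV. \<Sum>c\<in>UNIV. t a b c d)"
      by (intro sum.cong refl sum.swap)
    also have "\<dots> = (\<Sum>a\<in>UNIV. \<Sum>d\<in>UNIV. \<Sum>b\<in>UNIV. \<Sum>c\<in>UNIV. t a b c d)"
      by (intro sum.cong refl sum.swap)
    also have "\<dots> = (\<Sum>d\<in>UNIV. \<Sum>a\<in>UNIV. \<Sum>b\<in>UNIV. \<Sum>c\<in>UNIV. t a b c d)"
      by (rule sum.swap)
    also have "\<dots> = (\<Sum>d\<in>UNIV. \<Sum>b\<in>UNIV. \<Sum>a\<in>UNIV. \<Sum>c\<in>UNIV. t a b c d)"
      by (intro sum.cong refl sum.swap)
    also have "\<dots> = (\<Sum>d\<in>UNIV. \<Sum>b\<in>UNIV. \<Sum>c\<in>UNIV. \<Sum>a\<in>UNIV. t a b c d)"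
      by (intro sum.cong refl sum.swap)
    finally show ?thesis .
  qed
  have "(\<Sum>k\<in>UNIV. \<Sum>l\<in>UNIV. v $ k * dirder (\<lambda>y. G y $ k $ l) x X * w $ l)
     = (\<Sum>k\<in>UNIV. \<Sum>l\<in>UNIV. \<Sum>i\<in>UNIV. \<Sum>p\<in>UNIV. christoffel G x p i k * X $ i * v $ k * G x $ p $ l * w $ l)
     + (\<Sum>k\<in>UNIV. \<Sum>l\<in>UNIV. \<Sum>i\<in>UNIV. \<Sum>p\<in>UNIV. v $ k * G x $ k $ p * (christoffel G x p i l * X $ i * w $ l))"
    unfolding D lc by (simp add: sum_distrib_left sum_distrib_right sum.distrib algebra_simps)
  also have "(\<Sum>k\<in>UNIV. \<Sum>l\<in>UNIV. \<Sum>i\<in>UNIV. \<Sum>p\<in>UNIV. christoffel G x p i k * X $ i * v $ k * G x $ p $ l * w $ l)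
     = metric_inner (G x) (conn_form G x X v) w"
    by (subst swap1) (simp add: metric_inner_sum conn_form_def sum_distrib_right)
  also have "(\<Sum>k\<in>UNIV. \<Sum>l\<in>UNIV. \<Sum>i\<in>UNIV. \<Sum>p\<in>UNIV. v $ k * G x $ k $ p * (christoffel G x p i l * X $ i * w $ l))
     = metric_inner (G x) v (conn_form G x X w)"
  proof -
    have swap2: "(\<Sum>l\<in>UNIV. \<Sum>i\<in>UNIV. \<Sum>p\<in>UNIV. t l i p) = (\<Sum>p\<in>UNIV. \<Sum>i\<in>UNIV. \<Sum>l\<in>UNIV. t l i p)"
      for t :: "'k \<Rightarrow> 'k \<Rightarrow> 'k \<Rightarrow> real"
    proof -
      have "(\<Sum>l\<in>UNIV. \<Sum>i\<in>UNIV. \<Sum>p\<in>UNIV. t l i p) = (\<Sum>l\<in>UNIV. \<Sum>p\<in>UNIV. \<Sum>i\<in>UNIV. t l i p)"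
        by (intro sum.cong refl sum.swap)
      also have "\<dots> = (\<Sum>p\<in>UNIV. \<Sum>l\<in>UNIV. \<Sum>i\<in>UNIV. t l i p)" by (rule sum.swap)
      also have "\<dots> = (\<Sum>p\<in>UNIV. \<Sum>i\<in>UNIV. \<Sum>l\<in>UNIV. t l i p)"
        by (intro sum.cong refl sum.swap)
      finally show ?thesis .
    qed
    show ?thesis
      unfolding metric_inner_sum conn_form_def vec_lambda_beta sum_distrib_left sum_distrib_right
      by (rule sum.cong[OF refl], rule swap2)
  qed
  finally show ?thesis .
qed

text \<open>The product rule for the pull-back connection: by \<open>metric_derivative\<close>, the
  derivative of H along \<open>dirder f x X\<close> is exactly what the two Christoffel terms
  contribute. With f the identity it concerns a metric on the source itself.\<close>

lemma has_derivative_metric_inner: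
  fixes f :: "real^'m \<Rightarrow> real^'n" and H :: "real^'n \<Rightarrow> real^'n^'n"
  assumes V: "open V" "f x \<in> V" "\<And>y. y \<in> V \<Longrightarrow> positive_metric (H y)"
    and H: "\<And>k l. (\<lambda>y. H y $ k $ l) differentiable (at (f x))"
    and f: "f differentiable (at x)" and A: "A differentiable (at x)" and B: "B differentiable (at x)"
  shows "((\<lambda>y. metric_inner (H (f y)) (A y) (B y)) has_derivative
    (\<lambda>X. metric_inner (H (f x)) (pullback_conn H f A x X) (B x)
       + metric_inner (H (f x)) (A x) (pullback_conn H f B x X))) (at x)"
proof -
  have Ak: "((\<lambda>y. A y $ k) has_derivative (\<lambda>X. dirder A x X $ k)) (at x)"
    and Bk: "((\<lambda>y. B y $ k) has_derivative (\<lambda>X. dirder B x X $ k)) (at x)" for k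
    using A B by (auto intro: bounded_linear.has_derivative[OF bounded_linear_vec_nth] has_derivative_dirder)
  have Hkl: "((\<lambda>y. H (f y) $ k $ l) has_derivative (\<lambda>X. dirder (\<lambda>y. H y $ k $ l) (f x) (dirder f x X))) (at x)"
    for k l
    using has_derivative_compose[OF has_derivative_dirder[OF f] has_derivative_dirder[OF H]] .
  have "((\<lambda>y. metric_inner (H (f y)) (A y) (B y)) has_derivative
    (\<lambda>X. \<Sum>k\<in>UNIV. \<Sum>l\<in>UNIV. dirder A x X $ k * H (f x) $ k $ l * B x $ l
      + A x $ k * dirder (\<lambda>y. H y $ k $ l) (f x) (dirder f x X) * B x $ l
      + A x $ k * H (f x) $ k $ l * dirder B x X $ l)) (at x)"
    unfolding metric_inner_sum
    by (auto intro!: derivative_eq_intros Ak Bk Hkl sum.cong simp: algebra_simps)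
  moreover have "(\<Sum>k\<in>UNIV. \<Sum>l\<in>UNIV. dirder A x X $ k * H (f x) $ k $ l * B x $ l
      + A x $ k * dirder (\<lambda>y. H y $ k $ l) (f x) (dirder f x X) * B x $ l
      + A x $ k * H (f x) $ k $ l * dirder B x X $ l)
    = metric_inner (H (f x)) (pullback_conn H f A x X) (B x)
       + metric_inner (H (f x)) (A x) (pullback_conn H f B x X)" for X
    using metric_derivative[OF V H, of "A x" "dirder f x X" "B x"]
    by (simp add: sum.distrib pullback_conn_def linear_add[OF linear_metric_inner(1)]
        linear_add[OF linear_metric_inner(2)] flip: metric_inner_sum)
  ultimately show ?thesis by simp
qed

lemma differentiable_christoffel:
  fixes H :: "real^'n \<Rightarrow> real^'n^'n"
  assumes V: "open V" "y \<in> V" and H: "smooth_on V H" and p: "\<And>y. y \<in> V \<Longrightarrow> positive_metric (H y)"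
  shows "(\<lambda>y. christoffel H y k i j) differentiable (at y)"
proof -
  have s: "smooth_on V (\<lambda>y. H y $ i $ j)" for i j
    by (intro smooth_on_vec_nth V H)
  have "(\<lambda>y. matrix_inv (H y) $ i $ j) differentiable (at y)" for i j
    using smooth_on_differentiable[OF s V(2)] positive_metric_invertible[OF p]
    by (intro differentiable_matrix_inv[OF V]) auto
  moreover have "(\<lambda>y. dirder (\<lambda>y. H y $ i $ j) y v) differentiable (at y)" for i j v
    by (rule smooth_on_differentiable[OF smooth_on_dirder[OF s] V(2)])
  ultimately show ?thesis
    unfolding christoffel_def
    by (intro differentiable_mult differentiable_sum differentiable_add differentiable_diff differentiable_const ballI)
      auto
qed

text \<open>The evaluation along a map p covers both connections: the one of the target along f, and
  the one of the source with p the identity.\<close>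

lemma differentiable_conn_form:
  fixes K :: "real^'k \<Rightarrow> real^'k^'k" and p :: "real^'m \<Rightarrow> real^'k"
  assumes W: "open W" "p x \<in> W" and K: "smooth_on W K" "\<And>y. y \<in> W \<Longrightarrow> positive_metric (K y)"
    and "p differentiable (at x)" "A differentiable (at x)" "B differentiable (at x)"
  shows "(\<lambda>y. conn_form K (p y) (A y) (B y)) differentiable (at x)"
proof (rule differentiable_vecI)
  have "(\<lambda>y. christoffel K (p y) k i j) differentiable (at x)" for k i j
    using differentiable_chain_at[OF assms(5) differentiable_christoffel[OF W K]] by (simp add: o_def)
  then show "(\<lambda>y. conn_form K (p y) (A y) (B y) $ k) differentiable (at x)" for k
    unfolding conn_form_def vec_lambda_beta
    by (intro differentiable_sum differentiable_mult ballI differentiable_vec_nth assms) auto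
qed

section \<open>Conformal immersions in local coordinates\<close>

text \<open>One pair of charts: U and V stand for coordinate images, r for the exponent \<rho>, Gb
  for the pulled-back metric and G for its conformal change. The metrics are prescribed on U only,
  since component matrices have no meaning outside it.\<close>

locale local_conformal_immersion =
  fixes U :: "(real^'m) set" and V :: "(real^'n) set" and f :: "real^'m \<Rightarrow> real^'n"
    and H :: "real^'n \<Rightarrow> real^'n^'n" and r :: "real^'m \<Rightarrow> real" and Gb G :: "real^'m \<Rightarrow> real^'m^'m"
  assumes open_U: "open U" and open_V: "open V" and f_V: "\<And>x. x \<in> U \<Longrightarrow> f x \<in> V"
    and smooth_f: "smooth_on U f" and smooth_H: "smooth_on V H"
    and pos_H: "\<And>y. y \<in> V \<Longrightarrow> positive_metric (H y)"
    and inj_f: "\<And>x. x \<in> U \<Longrightarrow> inj (dirder f x)" and smooth_r: "smooth_on U r"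
    and Gb_eq: "\<And>x. x \<in> U \<Longrightarrow> Gb x = transpose (jacobian f (at x)) ** H (f x) ** jacobian f (at x)"
    and G_eq: "\<And>x. x \<in> U \<Longrightarrow> G x = exp (2 * r x) *\<^sub>R Gb x"
begin

text \<open>An isometric immersion is a conformal one with exponent zero. Facts about G thus hold
  for Gb with the derivatives of r gone; in particular they yield that the second fundamental form
  and its trace are normal.\<close>

lemma isometric: "local_conformal_immersion U V f H (\<lambda>x. 0) Gb Gb"
  using local_conformal_immersion_axioms
  by (simp add: local_conformal_immersion_def smooth_on_const)

abbreviation ip where "ip x \<equiv> metric_inner (H (f x))"
abbreviation df where "df x \<equiv> dirder f x"
abbreviation nabla_df where "nabla_df x X Y \<equiv> pullback_conn H f (\<lambda>y. dirder f y Y) x X"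

lemma differentiable_f: "x \<in> U \<Longrightarrow> f differentiable (at x)"
  by (rule smooth_on_differentiable[OF smooth_f])

lemma linear_df: "x \<in> U \<Longrightarrow> linear (df x)"
  by (intro linear_frechet_derivative differentiable_f)

lemma differentiable_df: "x \<in> U \<Longrightarrow> (\<lambda>y. df y v) differentiable (at x)"
  by (rule smooth_on_differentiable[OF smooth_on_dirder[OF smooth_f]])

lemma differentiable_r: "x \<in> U \<Longrightarrow> r differentiable (at x)"
  by (rule smooth_on_differentiable[OF smooth_r])

lemma linear_dr: "x \<in> U \<Longrightarrow> linear (dirder r x)"
  by (intro linear_frechet_derivative differentiable_r)

lemma smooth_H_entry: "smooth_on V (\<lambda>y. H y $ k $ l)"
  by (intro smooth_on_vec_nth open_V smooth_H)

lemma ip_commute: "x \<in> U \<Longrightarrow> ip x v w = ip x w v"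
  by (intro metric_inner_commute positive_metric_transpose pos_H f_V)

lemma metric_Gb: "x \<in> U \<Longrightarrow> metric_inner (Gb x) v w = ip x (df x v) (df x w)"
proof -
  assume x: "x \<in> U"
  have J: "jacobian f (at x) *v v = df x v" for v
    using jacobian_works[of f "at x"] differentiable_f[OF x] by (simp add: dirder_eqI)
  show ?thesis
    unfolding Gb_eq[OF x] metric_inner_def
    by (simp add: J flip: matrix_vector_mul_assoc)
      (metis J dot_lmul_matrix inner_commute transpose_matrix_vector)
qed

lemma pos_Gb: "x \<in> U \<Longrightarrow> positive_metric (Gb x)"
proof -
  assume x: "x \<in> U"
  have "transpose (Gb x) = Gb x"
    using positive_metric_transpose[OF pos_H[OF f_V[OF x]]]
    by (simp add: Gb_eq[OF x] matrix_transpose_mul matrix_mul_assoc)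
  moreover have "metric_inner (Gb x) v v > 0" if "v \<noteq> 0" for v
  proof -
    have "df x v \<noteq> 0"
      using inj_f[OF x] linear_df[OF x] that by (metis injD linear_0)
    then show ?thesis
      using pos_H[OF f_V[OF x]] by (simp add: metric_Gb[OF x] positive_metric_def)
  qed
  ultimately show ?thesis by (simp add: positive_metric_def)
qed

lemma pos_G: "x \<in> U \<Longrightarrow> positive_metric (G x)"
  by (simp add: G_eq positive_metric_scaleR pos_Gb)

lemma smooth_ip_df: "smooth_on U (\<lambda>x. ip x (df x v) (df x w))"
proof -
  have "smooth_on U (\<lambda>x. H (f x))"
    using smooth_on_compose[OF open_U _ smooth_f smooth_H] f_V by auto
  then show ?thesis
    unfolding metric_inner_sum
    by (intro smooth_on_sum smooth_on_mult smooth_on_vec_nth smooth_on_dirder smooth_f open_U)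
qed

lemma smooth_Gb: "smooth_on U Gb"
proof (intro smooth_on_vec open_U)
  show "smooth_on U (\<lambda>x. Gb x $ i $ j)" for i j
    using smooth_ip_df[of "axis i 1" "axis j 1"]
    by (rule smooth_on_cong[OF open_U, rotated]) (simp add: metric_Gb flip: metric_inner_axis)
qed

lemma smooth_G: "smooth_on U G"
proof (intro smooth_on_vec open_U)
  show "smooth_on U (\<lambda>x. G x $ i $ j)" for i j
  proof (rule smooth_on_cong[OF open_U])
    show "smooth_on U (\<lambda>x. exp (2 * r x) * Gb x $ i $ j)"
      by (intro smooth_on_mult smooth_on_exp smooth_on_vec_nth smooth_on_const open_U smooth_r smooth_Gb)
  qed (simp add: G_eq)
qed

text \<open>Schwarz's theorem for f, together with the vanishing torsion of the connection of
  H.\<close>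

lemma nabla_df_commute: "x \<in> U \<Longrightarrow> nabla_df x X Y = nabla_df x Y X"
  unfolding pullback_conn_def
  using dirder_commute[OF open_U _ smooth_f, of x X Y] 
    conn_form_commute[OF open_V f_V pos_H, where X = "df x X" and Y = "df x Y"]
  by simp

lemma has_derivative_ip:
  assumes "x \<in> U" "A differentiable (at x)" "B differentiable (at x)"
  shows "((\<lambda>y. ip y (A y) (B y)) has_derivative
    (\<lambda>X. ip x (pullback_conn H f A x X) (B x) + ip x (A x) (pullback_conn H f B x X))) (at x)"
  using assms
  by (intro has_derivative_metric_inner[OF open_V, of f x H A B] pos_H)
    (auto intro: differentiable_f smooth_on_differentiable[OF smooth_H_entry] f_V)

text \<open>Both sides compute the derivative of the metric \<open>Gb\<close>.\<close>

lemma metric_compatibility: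
  assumes x: "x \<in> U"
  shows "ip x (nabla_df x X Y) (df x Z) + ip x (df x Y) (nabla_df x X Z)
    = metric_inner (Gb x) (conn_form G x X Y) Z + metric_inner (Gb x) Y (conn_form G x X Z)
      - 2 * dirder r x X * metric_inner (Gb x) Y Z"
proof -
  have D1: "((\<lambda>y. ip y (df y Y) (df y Z)) has_derivative
     (\<lambda>X. ip x (nabla_df x X Y) (df x Z) + ip x (df x Y) (nabla_df x X Z))) (at x)"
    by (intro has_derivative_ip x differentiable_df)
  \<comment> \<open>For constant fields along the identity map the pull-back connection reduces to
    \<open>conn_form G\<close>.\<close>
  have "((\<lambda>y. metric_inner (G y) Y Z) has_derivative
      (\<lambda>X. metric_inner (G x) (pullback_conn G (\<lambda>y. y) (\<lambda>y. Y) x X) Z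
         + metric_inner (G x) Y (pullback_conn G (\<lambda>y. y) (\<lambda>y. Z) x X))) (at x)"
    using has_derivative_metric_inner[OF open_U, of "\<lambda>y. y" x G "\<lambda>y. Y" "\<lambda>y. Z"] x pos_G
      smooth_on_differentiable[OF smooth_on_vec_nth[OF open_U smooth_on_vec_nth[OF open_U smooth_G]] x]
    by simp
  then have D2: "((\<lambda>y. metric_inner (G y) Y Z) has_derivative
      (\<lambda>X. metric_inner (G x) (conn_form G x X Y) Z + metric_inner (G x) Y (conn_form G x X Z))) (at x)"
    by (simp add: pullback_conn_def)
  have "((\<lambda>y. exp (2 * r y) * ip y (df y Y) (df y Z)) has_derivative
     (\<lambda>X. exp (2 * r x) * (ip x (nabla_df x X Y) (df x Z) + ip x (df x Y) (nabla_df x X Z)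
        + 2 * dirder r x X * ip x (df x Y) (df x Z)))) (at x)"
    by (auto intro!: derivative_eq_intros D1 has_derivative_dirder[OF differentiable_r[OF x]]
        simp: algebra_simps)
  then have "((\<lambda>y. metric_inner (G y) Y Z) has_derivative
     (\<lambda>X. exp (2 * r x) * (ip x (nabla_df x X Y) (df x Z) + ip x (df x Y) (nabla_df x X Z)
        + 2 * dirder r x X * ip x (df x Y) (df x Z)))) (at x)"
    by (rule has_derivative_transform_within_open[OF _ open_U x])
      (simp add: G_eq metric_inner_scaleR metric_Gb)
  from fun_cong[OF has_derivative_unique[OF this D2], of X]
  have "exp (2 * r x) * (ip x (nabla_df x X Y) (df x Z) + ip x (df x Y) (nabla_df x X Z)
        + 2 * dirder r x X * metric_inner (Gb x) Y Z)
     = exp (2 * r x) * (metric_inner (Gb x) (conn_form G x X Y) Z + metric_inner (Gb x) Y (conn_form G x X Z))"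
    by (simp add: G_eq[OF x] metric_inner_scaleR metric_Gb[OF x] distrib_left)
  then show ?thesis by simp
qed

text \<open>Koszul's trick: a trilinear expression that is symmetric in its first two and antisymmetric in
  its last two arguments vanishes.\<close>

lemma hess_tangential:
  assumes x: "x \<in> U"
  shows "ip x (hess_map G H f x X Y) (df x Z) = metric_inner (Gb x) X Y * dirder r x Z
    - metric_inner (Gb x) Y Z * dirder r x X - metric_inner (Gb x) X Z * dirder r x Y"
proof -
  \<comment> \<open>Chosen so that \<open>A X Y Z = 0\<close> is the claim: the discrepancy between
    the two connections, corrected by the conformal terms that make it antisymmetric in Y and
    Z.\<close>
  define A where "A X Y Z = ip x (nabla_df x X Y) (df x Z) - metric_inner (Gb x) (conn_form G x X Y) Z
    + dirder r x X * metric_inner (Gb x) Y Z + dirder r x Y * metric_inner (Gb x) X Z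
    - dirder r x Z * metric_inner (Gb x) X Y" for X Y Z
  have sym: "metric_inner (Gb x) v w = metric_inner (Gb x) w v" for v w
    by (intro metric_inner_commute positive_metric_transpose pos_Gb x)
  have A1: "A X Y Z = A Y X Z" for X Y Z
    using nabla_df_commute[OF x, of X Y] conn_form_commute[OF open_U x pos_G, where X = X and Y = Y] sym[of X Y]
    by (simp add: A_def)
  have A2: "A X Y Z = - A X Z Y" for X Y Z
    using metric_compatibility[OF x, where X = X and Y = Y and Z = Z] ip_commute[OF x, of "df x Y" "nabla_df x X Z"]
      sym[of Y "conn_form G x X Z"] sym[of Y Z] sym[of X Y] sym[of X Z]
    by (simp add: A_def algebra_simps)
  \<comment> \<open>Six alternating moves return to the initial order of the arguments; three of
    them change the sign, so A equals its own negative.\<close>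
  have "A X Y Z = 0"
    using A1[of X Y Z] A2[of Y X Z] A1[of Y Z X] A2[of Z Y X] A1[of Z X Y] A2[of X Z Y] by linarith
  moreover have "ip x (hess_map G H f x X Y) (df x Z)
      = ip x (nabla_df x X Y) (df x Z) - metric_inner (Gb x) (conn_form G x X Y) Z"
    by (simp add: hess_map_def metric_Gb[OF x] linear_diff[OF linear_metric_inner(2)])
  ultimately show ?thesis by (simp add: A_def mult.commute)
qed

lemma metric_trace_G: "x \<in> U \<Longrightarrow> metric_trace (G x) b = exp (- (2 * r x)) *\<^sub>R metric_trace (Gb x) b"
  by (simp add: G_eq metric_trace_scaleR positive_metric_invertible pos_Gb exp_minus inverse_eq_divide)

text \<open>Tracing the metric term of \<open>hess_tangential\<close> gives the dimension, and each
  of the two contractions takes away one. The factor is zero for surfaces and 2 in dimension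
  four.\<close>

lemma tension_tangential:
  assumes x: "x \<in> U"
  shows "ip x (tension G H f x) (df x Z) = (real CARD('m) - 2) * exp (- (2 * r x)) * dirder r x Z"
proof -
  note pos = pos_Gb[OF x]
  let ?g = "metric_inner (Gb x)"
  have "ip x (tension G H f x) (df x Z)
     = exp (- (2 * r x)) * metric_trace (Gb x) (\<lambda>X Y. ip x (hess_map G H f x X Y) (df x Z))"
    unfolding tension_def metric_trace_G[OF x]
    by (simp add: metric_trace_linear[OF linear_metric_inner(2)] linear_cmul[OF linear_metric_inner(2)])
  also have "metric_trace (Gb x) (\<lambda>X Y. ip x (hess_map G H f x X Y) (df x Z))
     = metric_trace (Gb x) (\<lambda>X Y. dirder r x Z * ?g X Y
        + ((- 1) * (?g Y Z * dirder r x X) + (- 1) * (?g X Z * dirder r x Y)))"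
    by (simp add: hess_tangential[OF x] algebra_simps)
  also have "\<dots> = (real CARD('m) - 2) * dirder r x Z"
    unfolding metric_trace_add metric_trace_cmult
    by (simp add: metric_trace_metric[OF pos, unfolded eta_contract_eq] metric_trace_contract[OF pos linear_dr[OF x]] algebra_simps)
  finally show ?thesis by simp
qed

lemma differentiable_conn_form_G: "x \<in> U \<Longrightarrow> (\<lambda>y. conn_form G y X Y) differentiable (at x)"
  by (rule differentiable_conn_form[OF open_U, of "\<lambda>y. y"]) (auto intro: smooth_G pos_G)

lemma differentiable_matrix_inv_G: "x \<in> U \<Longrightarrow> (\<lambda>y. matrix_inv (G y) $ i $ j) differentiable (at x)"
  by (rule differentiable_matrix_inv[OF open_U])
    (auto intro!: positive_metric_invertible pos_G
      smooth_on_differentiable[OF smooth_on_vec_nth[OF open_U smooth_on_vec_nth[OF open_U smooth_G]]])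

lemma differentiable_hess:
  assumes x: "x \<in> U"
  shows "(\<lambda>y. hess_map G H f y X Y) differentiable (at x)"
proof -
  \<comment> \<open>The argument of \<open>df y\<close> varies with y; expansion in coordinate
    vectors reduces it to derivatives of f in fixed directions.\<close>
  have "(\<lambda>y. \<Sum>k\<in>UNIV. conn_form G y X Y $ k *\<^sub>R df y (axis k 1)) differentiable (at x)"
    by (intro differentiable_sum differentiable_scaleR ballI differentiable_df[OF x]
        differentiable_vec_nth differentiable_conn_form_G[OF x]) auto
  then have "(\<lambda>y. df y (conn_form G y X Y)) differentiable (at x)"
  proof (rule differentiable_cong_open[OF _ open_U x])
    fix y assume y: "y \<in> U"
    have "df y v = (\<Sum>k\<in>UNIV. v $ k *\<^sub>R df y (axis k 1))" for v
      using basis_expansion[of v] linear_sum[OF linear_df[OF y], of "\<lambda>k. v $ k *\<^sub>R axis k 1" UNIV]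
      by (simp add: scalar_mult_eq_scaleR linear_cmul[OF linear_df[OF y]])
    from this[symmetric]
    show "(\<Sum>k\<in>UNIV. conn_form G y X Y $ k *\<^sub>R df y (axis k 1)) = df y (conn_form G y X Y)" .
  qed
  moreover have "(\<lambda>y. conn_form H (f y) (df y X) (df y Y)) differentiable (at x)"
    by (intro differentiable_conn_form[OF open_V, of f] smooth_H pos_H f_V differentiable_f differentiable_df x)
  moreover have "(\<lambda>y. dirder (\<lambda>y. df y Y) y X) differentiable (at x)"
    by (rule smooth_on_differentiable[OF smooth_on_dirder[OF smooth_on_dirder[OF smooth_f]] x])
  ultimately show ?thesis
    unfolding hess_map_def pullback_conn_def by simp
qed

lemma differentiable_tension: "x \<in> U \<Longrightarrow> tension G H f differentiable (at x)"
  unfolding tension_def[abs_def] metric_trace_def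
  by (intro differentiable_sum differentiable_scaleR ballI differentiable_hess differentiable_matrix_inv_G) auto

text \<open>The product rule applied to \<open>tension_tangential\<close>, whose factor is 2 here;
  the coefficient 4 is this 2 times the 2 from differentiating the exponential.\<close>

lemma nabla_tension:
  assumes x: "x \<in> U" and m: "CARD('m) = 4"
  shows "ip x (df x Z) (pullback_conn H f (tension G H f) x Y)
    = exp (- (2 * r x)) * (2 * dirder (\<lambda>y. dirder r y Z) x Y - 4 * dirder r x Y * dirder r x Z)
      - ip x (tension G H f x) (nabla_df x Y Z)"
proof -
  have "((\<lambda>y. ip y (tension G H f y) (df y Z)) has_derivative
    (\<lambda>Y. ip x (pullback_conn H f (tension G H f) x Y) (df x Z) + ip x (tension G H f x) (nabla_df x Y Z))) (at x)"
    by (intro has_derivative_ip x differentiable_tension differentiable_df)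
  then have 1: "((\<lambda>y. 2 * exp (- (2 * r y)) * dirder r y Z) has_derivative
    (\<lambda>Y. ip x (pullback_conn H f (tension G H f) x Y) (df x Z) + ip x (tension G H f x) (nabla_df x Y Z))) (at x)"
    by (rule has_derivative_transform_within_open[OF _ open_U x]) (simp add: tension_tangential m)
  have "((\<lambda>y. 2 * exp (- (2 * r y)) * dirder r y Z) has_derivative
    (\<lambda>Y. exp (- (2 * r x)) * (2 * dirder (\<lambda>y. dirder r y Z) x Y - 4 * dirder r x Y * dirder r x Z))) (at x)"
    by (auto intro!: derivative_eq_intros has_derivative_dirder[OF differentiable_r[OF x]]
        has_derivative_dirder[OF smooth_on_differentiable[OF smooth_on_dirder[OF smooth_r] x]]
        simp: algebra_simps)
  from fun_cong[OF has_derivative_unique[OF 1 this], of Y]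
  show ?thesis by (simp add: ip_commute[OF x, of "df x Z"])
qed

section \<open>The second fundamental form and the stress-energy tensor\<close>

abbreviation sff where "sff x \<equiv> hess_map Gb H f x"
abbreviation taub where "taub x \<equiv> tension Gb H f x"

lemma sff_normal: "x \<in> U \<Longrightarrow> ip x (sff x X Y) (df x Z) = 0"
  using local_conformal_immersion.hess_tangential[OF isometric] by simp

lemma taub_normal: "x \<in> U \<Longrightarrow> ip x (taub x) (df x Z) = 0"
  using local_conformal_immersion.tension_tangential[OF isometric] by simp

lemma nabla_df_eq: "nabla_df x X Y = sff x X Y + df x (conn_form Gb x X Y)"
  by (simp add: hess_map_def)

lemma conn_form_Gb_commute: "x \<in> U \<Longrightarrow> conn_form Gb x X Y = conn_form Gb x Y X"
  by (intro conn_form_commute[OF open_U _ pos_Gb])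

lemma sff_commute: "x \<in> U \<Longrightarrow> sff x X Y = sff x Y X"
  using nabla_df_commute[of x X Y] conn_form_Gb_commute[of x X Y] by (simp add: hess_map_def)

text \<open>A change of the source connection alters the Hessian only by a vector in the image of
  \<open>df x\<close>. The existence of w is enough, since w can be identified later through its
  inner products.\<close>

lemma tension_decomposition:
  assumes x: "x \<in> U"
  obtains w where "tension G H f x = exp (- (2 * r x)) *\<^sub>R taub x + df x w"
proof
  have eq: "hess_map G H f x = (\<lambda>X Y. sff x X Y + df x (conn_form Gb x X Y - conn_form G x X Y))"
    by (simp add: hess_map_def linear_diff[OF linear_df[OF x]] fun_eq_iff)
  show "tension G H f x = exp (- (2 * r x)) *\<^sub>R taub x
      + df x (exp (- (2 * r x)) *\<^sub>R metric_trace (Gb x) (\<lambda>X Y. conn_form Gb x X Y - conn_form G x X Y))"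
    unfolding tension_def metric_trace_G[OF x] eq metric_trace_add
    by (simp add: metric_trace_linear[OF linear_df[OF x]] linear_cmul[OF linear_df[OF x]] scaleR_add_right)
qed

abbreviation lap where
  "lap x \<equiv> metric_trace (Gb x) (\<lambda>X Y. dirder (\<lambda>y. dirder r y Y) x X - dirder r x (conn_form Gb x X Y))"

text \<open>In \<open>nabla_tension\<close> the field \<open>nabla_df\<close> is split. Its normal
  part pairs with the normal part of \<tau>; its tangential part supplies the Christoffel term that
  completes the second partial derivatives of r to the covariant Hessian for Gb.\<close>

lemma nabla_tension_Gb:
  assumes x: "x \<in> U" and m: "CARD('m) = 4"
  shows "ip x (df x X) (pullback_conn H f (tension G H f) x Y) = exp (- (2 * r x)) *
    (2 * (dirder (\<lambda>y. dirder r y Y) x X - dirder r x (conn_form Gb x X Y))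
      - 4 * (dirder r x X * dirder r x Y) - ip x (sff x X Y) (taub x))"
proof -
  obtain w where w: "tension G H f x = exp (- (2 * r x)) *\<^sub>R taub x + df x w"
    using tension_decomposition[OF x] .
  have "ip x (tension G H f x) (nabla_df x Y X)
    = ip x (tension G H f x) (sff x Y X) + ip x (tension G H f x) (df x (conn_form Gb x Y X))"
    by (simp add: nabla_df_eq linear_add[OF linear_metric_inner(1)])
  also have "ip x (tension G H f x) (sff x Y X) = exp (- (2 * r x)) * ip x (sff x X Y) (taub x)"
    using sff_normal[OF x, of X Y w] ip_commute[OF x, of "sff x X Y"] sff_commute[OF x, of X Y]
    by (simp add: w linear_add[OF linear_metric_inner(2)] linear_cmul[OF linear_metric_inner(2)])
  also have "ip x (tension G H f x) (df x (conn_form Gb x Y X))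
      = 2 * exp (- (2 * r x)) * dirder r x (conn_form Gb x X Y)"
    using conn_form_Gb_commute[OF x, of X Y] by (simp add: tension_tangential[OF x] m)
  finally show ?thesis
    using dirder_commute_real[OF open_U x smooth_r, of X Y]
    by (simp add: nabla_tension[OF x m] algebra_simps)
qed

text \<open>Pythagoras: with \<open>u = exp (- (2 * r x))\<close>, the normal part is u times
  \<open>taub x\<close>, and the tangential part is the image of 2 u times the gradient of r for
  Gb.\<close>

lemma norm_tension:
  assumes x: "x \<in> U" and m: "CARD('m) = 4"
  shows "ip x (tension G H f x) (tension G H f x) = exp (- (2 * r x)) * exp (- (2 * r x)) *
    (ip x (taub x) (taub x) + 4 * metric_trace (Gb x) (\<lambda>X Y. dirder r x X * dirder r x Y))"
proof -
  define u where "u = exp (- (2 * r x))"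
  have u: "u > 0" by (simp add: u_def)
  obtain w where w: "tension G H f x = u *\<^sub>R taub x + df x w"
    using tension_decomposition[OF x] unfolding u_def .
  note lin = linear_add[OF linear_metric_inner(1)] linear_cmul[OF linear_metric_inner(1)]
     linear_add[OF linear_metric_inner(2)] linear_cmul[OF linear_metric_inner(2)]
  have wZ: "metric_inner (Gb x) w Z = 2 * u * dirder r x Z" for Z
    using tension_tangential[OF x, of Z] taub_normal[OF x, of Z]
    by (simp add: m w lin metric_Gb[OF x] u_def)
  have "dirder r x X = 1 / (2 * u) * metric_inner (Gb x) X w" for X
    using wZ[of X] u metric_inner_commute[OF positive_metric_transpose[OF pos_Gb[OF x]], of X w] by simp
  \<comment> \<open>One of the two factors is rewritten as a product with w, so that the trace
    becomes a contraction.\<close>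
  then have "metric_trace (Gb x) (\<lambda>X Y. dirder r x X * dirder r x Y)
     = metric_trace (Gb x) (\<lambda>X Y. 1 / (2 * u) * (metric_inner (Gb x) X w * dirder r x Y))"
    by (simp add: mult_ac)
  also have "\<dots> = 1 / (2 * u) * dirder r x w"
    by (simp only: metric_trace_cmult metric_trace_contract[OF pos_Gb[OF x] linear_dr[OF x]])
  finally have "4 * u * u * metric_trace (Gb x) (\<lambda>X Y. dirder r x X * dirder r x Y) = metric_inner (Gb x) w w"
    using u wZ[of w] by simp
  moreover have "ip x (tension G H f x) (tension G H f x) = u * u * ip x (taub x) (taub x) + metric_inner (Gb x) w w"
    using taub_normal[OF x, of w] ip_commute[OF x, of "df x w" "taub x"]
    by (simp add: w lin metric_Gb[OF x])
  ultimately show ?thesis unfolding u_def[symmetric] by (simp add: algebra_simps)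
qed

text \<open>Write u for the exponential, q for |dr|^2 and t for |\<open>taub x\<close>|^2, both
  measured without the conformal factor. As G is Gb divided by u, the metric term has coefficient u
  times (t + 4 q) / 2 + (2 \<open>lap x\<close> - 4 q - t). The other two terms of S_2 coincide by
  symmetry, whence 8, -4 and 2.\<close>

lemma stress_formula:
  assumes x: "x \<in> U" and m: "CARD('m) = 4"
  shows "bienergy_stress G H f x X Y = exp (- (2 * r x)) *
     ((2 * lap x - 2 * metric_trace (Gb x) (\<lambda>X Y. dirder r x X * dirder r x Y)
        - 1 / 2 * ip x (taub x) (taub x)) * metric_inner (Gb x) X Y
      + 8 * (dirder r x X * dirder r x Y)
      - 4 * (dirder (\<lambda>y. dirder r y Y) x X - dirder r x (conn_form Gb x X Y))
      + 2 * ip x (sff x X Y) (taub x))"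
proof -
  define u where "u = exp (- (2 * r x))"
  have ue: "exp (2 * r x) = 1 / u" by (simp add: u_def exp_minus inverse_eq_divide)
  have u: "u > 0" by (simp add: u_def)
  define D where "D = (\<lambda>X Y. dirder (\<lambda>y. dirder r y Y) x X - dirder r x (conn_form Gb x X Y))"
  define q where "q = metric_trace (Gb x) (\<lambda>X Y. dirder r x X * dirder r x Y)"
  define t where "t = ip x (taub x) (taub x)"
  define b where "b X Y = ip x (sff x X Y) (taub x)" for X Y
  have D_commute: "D X Y = D Y X" for X Y
    using dirder_commute_real[OF open_U x smooth_r, of X Y] conn_form_Gb_commute[OF x, of X Y]
    by (simp add: D_def)
  have b_commute: "b X Y = b Y X" for X Y
    using sff_commute[OF x, of X Y] by (simp add: b_def)
  \<comment> \<open>\<open>taub\<close> is itself the trace of \<open>sff\<close>, so the trace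
    passes through the product with the fixed vector \<open>taub x\<close>.\<close>
  have b_trace: "metric_trace (Gb x) b = t"
    unfolding b_def[abs_def] t_def tension_def[of Gb]
    using metric_trace_linear[OF linear_metric_inner(2)] by metis
  have N: "ip x (df x X) (pullback_conn H f (tension G H f) x Y)
      = u * (2 * D X Y + ((- 4) * (dirder r x X * dirder r x Y) + (- 1) * b X Y))" for X Y
    by (simp add: nabla_tension_Gb[OF x m] u_def D_def b_def)
  have tr: "metric_trace (G x) (\<lambda>Z W. ip x (df x Z) (pullback_conn H f (tension G H f) x W))
     = u * (u * (2 * metric_trace (Gb x) D - 4 * q - t))"
    unfolding N metric_trace_G[OF x] metric_trace_cmult metric_trace_add b_trace
    by (simp add: q_def u_def algebra_simps)
  have mG: "metric_inner (G x) X Y = 1 / u * metric_inner (Gb x) X Y" for X Y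
    by (simp add: G_eq[OF x] metric_inner_scaleR ue)
  have "bienergy_stress G H f x X Y = (1/2 * (u * u * (t + 4 * q)) + u * (u * (2 * metric_trace (Gb x) D - 4 * q - t)))
      * (1 / u * metric_inner (Gb x) X Y)
      - u * (2 * D X Y + ((- 4) * (dirder r x X * dirder r x Y) + (- 1) * b X Y))
      - u * (2 * D Y X + ((- 4) * (dirder r x Y * dirder r x X) + (- 1) * b Y X))"
    unfolding bienergy_stress_def Let_def tr mG norm_tension[OF x m]
    unfolding N by (simp only: u_def q_def t_def mult.assoc distrib_right)
  also have "\<dots> = u * ((2 * metric_trace (Gb x) D - 2 * q - 1 / 2 * t) * metric_inner (Gb x) X Y
      + 8 * (dirder r x X * dirder r x Y) - 4 * D X Y + 2 * b X Y)"
    using u D_commute[of Y X] b_commute[of Y X] by (simp add: field_simps)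
  finally show ?thesis by (simp add: u_def D_def q_def t_def b_def)
qed

lemma lap_zero:
  assumes x: "x \<in> U" and m: "CARD('m) = 4" and S: "\<And>X Y. bienergy_stress G H f x X Y = 0"
  shows "lap x = 0"
proof -
  define D where "D = (\<lambda>X Y. dirder (\<lambda>y. dirder r y Y) x X - dirder r x (conn_form Gb x X Y))"
  define q where "q = metric_trace (Gb x) (\<lambda>X Y. dirder r x X * dirder r x Y)"
  define t where "t = ip x (taub x) (taub x)"
  define b where "b X Y = ip x (sff x X Y) (taub x)" for X Y
  have b_trace: "metric_trace (Gb x) b = t"
    unfolding b_def[abs_def] t_def tension_def[of Gb]
    using metric_trace_linear[OF linear_metric_inner(2)] by metis
  have "0 = (2 * metric_trace (Gb x) D - 2 * q - 1 / 2 * t) * metric_inner (Gb x) X Y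
      + (8 * (dirder r x X * dirder r x Y) + ((- 4) * D X Y + 2 * b X Y))" for X Y
    using S[of X Y] unfolding stress_formula[OF x m] by (simp add: D_def q_def t_def b_def)
  then have "metric_trace (Gb x) (\<lambda>X Y. 0)
    = metric_trace (Gb x) (\<lambda>X Y. (2 * metric_trace (Gb x) D - 2 * q - 1 / 2 * t) * metric_inner (Gb x) X Y
      + (8 * (dirder r x X * dirder r x Y) + ((- 4) * D X Y + 2 * b X Y)))"
    by presburger
  \<comment> \<open>The dimension is decisive here: multiplied by 4, the terms -2 q and -t / 2
    cancel against 8 q and 2 t, while of the Laplacian 8 - 4 = 4 copies remain.\<close>
  also have "\<dots> = (2 * metric_trace (Gb x) D - 2 * q - 1 / 2 * t) * 4
      + (8 * q + ((- 4) * metric_trace (Gb x) D + 2 * t))"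
    unfolding metric_trace_add metric_trace_cmult b_trace q_def
    by (simp add: metric_trace_metric[OF pos_Gb[OF x]] m)
  finally show ?thesis by (simp add: D_def metric_trace_def)
qed

text \<open>All derivatives of r drop out of \<open>stress_formula\<close>. What is left is twice
  the product of \<open>sff\<close> with \<open>taub\<close>, balanced against half of
  |\<open>taub\<close>|^2 times the metric.\<close>

lemma pseudo_umbilical_if_constant:
  assumes x: "x \<in> U" and m: "CARD('m) = 4" and S: "\<And>X Y. bienergy_stress G H f x X Y = 0"
    and c: "\<And>y. y \<in> U \<Longrightarrow> r y = c"
  shows "ip x (sff x X Y) (taub x) = 1 / 4 * ip x (taub x) (taub x) * metric_inner (Gb x) X Y"
proof -
  have d: "dirder r y v = 0" if "y \<in> U" for y v
    using dirder_cong_open[OF open_U that, of r "\<lambda>y. c"] c by simp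
  then have "dirder (\<lambda>y. dirder r y Y) x X = 0" for X Y
    using dirder_cong_open[OF open_U x, of "\<lambda>y. dirder r y Y" "\<lambda>y. 0"] by simp
  with S[of X Y] d[OF x] show ?thesis
    unfolding stress_formula[OF x m] by (simp add: metric_trace_def)
qed

section \<open>Harmonicity of the exponent and the maximum principle\<close>

text \<open>The Christoffel term of the Laplacian is of first order in r and becomes the drift,
  which is the shape the maximum principle accepts.\<close>

lemma harmonic:
  assumes x: "x \<in> U" and m: "CARD('m) = 4" and S: "\<And>X Y. bienergy_stress G H f x X Y = 0"
  shows "elliptic_op Gb (\<lambda>x. - metric_trace (Gb x) (conn_form Gb x)) r x = 0"
proof -
  have "lap x = metric_trace (Gb x) (\<lambda>X Y. dirder (\<lambda>y. dirder r y Y) x X + (- 1) * dirder r x (conn_form Gb x X Y))"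
    by simp
  also have "\<dots> = elliptic_op Gb (\<lambda>x. - metric_trace (Gb x) (conn_form Gb x)) r x"
    unfolding metric_trace_add metric_trace_cmult elliptic_op_def
    by (simp add: metric_trace_linear[OF linear_dr[OF x]] linear_neg[OF linear_dr[OF x]])
  finally show ?thesis using lap_zero[OF assms] by simp
qed

text \<open>K is any upper bound on U, attained or not, because one global maximum has to serve
  every chart. Continuity of the coefficients comes from their differentiability.\<close>

lemma max_set_open:
  assumes m: "CARD('m) = 4" and S: "\<And>x X Y. x \<in> U \<Longrightarrow> bienergy_stress G H f x X Y = 0"
    and le: "\<And>x. x \<in> U \<Longrightarrow> r x \<le> K"
  shows "open {x \<in> U. r x = K}"
proof (rule strong_maximum_principle[OF open_U smooth_r pos_Gb _ _ _ le])
  have cont: "continuous_on U F" if "\<And>x. x \<in> U \<Longrightarrow> F differentiable (at x)"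
    for F :: "real^'m \<Rightarrow> 'b::real_normed_vector"
    using that by (intro continuous_at_imp_continuous_on) (auto intro: differentiable_imp_continuous_within)
  have inv: "continuous_on U (\<lambda>x. matrix_inv (Gb x) $ i $ j)" for i j
    by (intro cont local_conformal_immersion.differentiable_matrix_inv_G[OF isometric])
  then have "continuous_on U (\<lambda>x. \<chi> i j. matrix_inv (Gb x) $ i $ j)"
    by (intro continuous_on_vec_lambda)
  then show "continuous_on U (\<lambda>x. matrix_inv (Gb x))"
    by (simp add: vec_lambda_eta)
  have "continuous_on U (\<lambda>x. conn_form Gb x X Y)" for X Y
    by (intro cont local_conformal_immersion.differentiable_conn_form_G[OF isometric])
  then show "continuous_on U (\<lambda>x. - metric_trace (Gb x) (conn_form Gb x))"
    unfolding metric_trace_def by (intro continuous_intros inv)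
qed (simp_all add: harmonic m S)

end

section \<open>Charts and pulled-back metrics\<close>

lemma chart_inj_on: "chart_on T c \<Longrightarrow> inj_on (coord c) (dom_of c)"
  unfolding chart_on_def
  by (metis homeomorphic_imp_injective_map openin_subset topspace_subtopology_subset)

lemma param_coord: "chart_on T c \<Longrightarrow> p \<in> dom_of c \<Longrightarrow> param c (coord c p) = p"
  by (simp add: inv_into_f_f chart_inj_on)

lemma open_coord_image:
  assumes c: "chart_on T c" and S: "openin T S" "S \<subseteq> dom_of c"
  shows "open (coord c ` S)"
proof -
  have "open_map (subtopology T (dom_of c)) (top_of_set (coord c ` dom_of c)) (coord c)"
    using c by (simp add: chart_on_def homeomorphic_imp_open_map)
  moreover have "openin (subtopology T (dom_of c)) S"
    using S by (simp add: openin_subset_topspace_eq openin_open_subtopology openin_subtopology_Int2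
        c[unfolded chart_on_def])
  ultimately have "openin (top_of_set (coord c ` dom_of c)) (coord c ` S)"
    by (simp add: open_map_def)
  then show ?thesis
    using c openin_open_trans by (auto simp: chart_on_def)
qed

lemma openin_coord_preimage:
  assumes c: "chart_on T c" and W: "open W"
  shows "openin T {p \<in> dom_of c. coord c p \<in> W}"
proof -
  have dom: "openin T (dom_of c)" using c by (simp add: chart_on_def)
  have "continuous_map (subtopology T (dom_of c)) (top_of_set (coord c ` dom_of c)) (coord c)"
    using c unfolding chart_on_def by (blast intro: homeomorphic_imp_continuous_map)
  then have "continuous_map (subtopology T (dom_of c)) euclidean (coord c)"
    by (simp add: continuous_map_in_subtopology)
  then have "openin (subtopology T (dom_of c)) {p \<in> topspace (subtopology T (dom_of c)). coord c p \<in> W}"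
    using W by (intro openin_continuous_map_preimage) auto
  moreover have "topspace (subtopology T (dom_of c)) = dom_of c"
    using openin_subset[OF dom] by auto
  ultimately have "openin (subtopology T (dom_of c)) {p \<in> dom_of c. coord c p \<in> W}"
    by (simp only:)
  then show ?thesis using dom by (rule openin_trans_full)
qed

lemma atlas_chart: "smooth_manifold M \<Longrightarrow> c \<in> atlas M \<Longrightarrow> chart_on (mtop M) c"
  by (simp add: smooth_manifold_def smooth_atlas_def)

lemma atlas_cover:
  assumes "smooth_manifold M" "p \<in> topspace (mtop M)"
  obtains c where "c \<in> atlas M" "p \<in> dom_of c"
proof -
  have "p \<in> (\<Union>c\<in>atlas M. dom_of c)"
    using assms by (simp add: smooth_manifold_def smooth_atlas_def)
  then show thesis using that by blast
qed

lemma chart_topspace: "smooth_manifold M \<Longrightarrow> c \<in> atlas M \<Longrightarrow> p \<in> dom_of c \<Longrightarrow> p \<in> topspace (mtop M)"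
  using atlas_chart[of M c] openin_subset[of "mtop M" "dom_of c"] by (auto simp: chart_on_def)

lemma open_coord_dom: "smooth_manifold M \<Longrightarrow> c \<in> atlas M \<Longrightarrow> open (coord c ` dom_of c)"
  using atlas_chart[of M c] by (simp add: chart_on_def)

lemma open_coord_overlap:
  assumes "smooth_manifold M" "c \<in> atlas M" "d \<in> atlas M"
  shows "open (coord c ` (dom_of c \<inter> dom_of d))"
  using atlas_chart[OF assms(1,2)] atlas_chart[OF assms(1,3)]
  by (intro open_coord_image[of "mtop M"]) (auto simp: chart_on_def)

lemma transition_differentiable:
  assumes "smooth_manifold M" "c \<in> atlas M" "d \<in> atlas M" "p \<in> dom_of c" "p \<in> dom_of d"
  shows "transition c d differentiable (at (coord c p))"
proof (rule smooth_on_differentiable)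
  show "smooth_on (coord c ` (dom_of c \<inter> dom_of d)) (transition c d)"
    using assms by (simp add: smooth_manifold_def smooth_atlas_def compatible_def)
qed (use assms in auto)

text \<open>The preimage under \<phi> is taken in the whole type; cut down to the chart domain it
  lies in the space, where continuity of \<phi> applies.\<close>

lemma open_coord_map_dom:
  assumes M: "smooth_manifold M" "c \<in> atlas M" and N: "smooth_manifold N" "d \<in> atlas N"
    and \<phi>: "smooth_map M N \<phi>"
  shows "open (coord c ` (dom_of c \<inter> \<phi> -` dom_of d))"
proof (rule open_coord_image[OF atlas_chart[OF M]])
  have "openin (mtop M) {p \<in> topspace (mtop M). \<phi> p \<in> dom_of d}"
    using \<phi> atlas_chart[OF N]
    by (intro openin_continuous_map_preimage) (auto simp: smooth_map_def chart_on_def)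
  then have "openin (mtop M) (dom_of c \<inter> {p \<in> topspace (mtop M). \<phi> p \<in> dom_of d})"
    using atlas_chart[OF M] by (intro openin_Int) (auto simp: chart_on_def)
  moreover have "dom_of c \<inter> {p \<in> topspace (mtop M). \<phi> p \<in> dom_of d} = dom_of c \<inter> \<phi> -` dom_of d"
    using chart_topspace[OF M] by auto
  ultimately show "openin (mtop M) (dom_of c \<inter> \<phi> -` dom_of d)" by simp
qed auto

lemma map_rep_coord:
  "smooth_manifold M \<Longrightarrow> c \<in> atlas M \<Longrightarrow> p \<in> dom_of c \<Longrightarrow> map_rep \<phi> c d (coord c p) = coord d (\<phi> p)"
  by (simp add: map_rep_def param_coord[OF atlas_chart])

lemma metric_rep_coord:
  "smooth_manifold M \<Longrightarrow> c \<in> atlas M \<Longrightarrow> p \<in> dom_of c \<Longrightarrow> metric_rep g c (coord c p) = g c p"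
  by (simp add: metric_rep_def param_coord[OF atlas_chart])

lemma map_rep_differentiable:
  assumes "smooth_map M N \<phi>" "c \<in> atlas M" "d \<in> atlas N" "p \<in> dom_of c" "\<phi> p \<in> dom_of d"
  shows "map_rep \<phi> c d differentiable (at (coord c p))"
  using assms
  by (intro smooth_on_differentiable[of "coord c ` (dom_of c \<inter> \<phi> -` dom_of d)"])
    (auto simp: smooth_map_def)

lemma jacobian_compose:
  fixes f :: "real^'a \<Rightarrow> real^'b" and g :: "real^'b \<Rightarrow> real^'c"
  assumes "f differentiable (at x)" "g differentiable (at (f x))"
  shows "jacobian (g \<circ> f) (at x) = jacobian g (at (f x)) ** jacobian f (at x)"
  unfolding jacobian_def frechet_derivative_compose[OF assms]
  by (intro matrix_compose linear_frechet_derivative assms)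

lemma jacobian_cong_open:
  fixes f g :: "real^'a \<Rightarrow> real^'b"
  assumes "open U" "x \<in> U" "\<And>y. y \<in> U \<Longrightarrow> f y = g y"
  shows "jacobian f (at x) = jacobian g (at x)"
  using dirder_cong_open[OF assms] by (simp add: jacobian_def)

text \<open>The chart \<open>d'\<close> picked by \<open>SOME\<close> gives way to any d around the
  image point: its Jacobian is \<open>K ** J\<close>, with K that of the transition, and the
  transformation law of h absorbs K.\<close>

lemma pullback_metric_chart:
  assumes M: "smooth_manifold M" "c \<in> atlas M" and N: "smooth_manifold N" "d \<in> atlas N"
    and h: "riemannian_metric N h" and \<phi>: "smooth_map M N \<phi>"
    and p: "p \<in> dom_of c" "\<phi> p \<in> dom_of d"
  defines "J \<equiv> jacobian (map_rep \<phi> c d) (at (coord c p))"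
  shows "pullback_metric N h \<phi> c p = transpose J ** h d (\<phi> p) ** J"
proof -
  define d' where "d' = (SOME d. d \<in> atlas N \<and> \<phi> p \<in> dom_of d)"
  have d': "d' \<in> atlas N" "\<phi> p \<in> dom_of d'"
    using someI[of "\<lambda>d. d \<in> atlas N \<and> \<phi> p \<in> dom_of d" d] N p unfolding d'_def by auto
  define K where "K = jacobian (transition d d') (at (coord d (\<phi> p)))"
  have "jacobian (map_rep \<phi> c d') (at (coord c p))
      = jacobian (transition d d' \<circ> map_rep \<phi> c d) (at (coord c p))"
  proof (rule jacobian_cong_open)
    show "open (coord c ` (dom_of c \<inter> \<phi> -` dom_of d))"
      by (rule open_coord_map_dom[OF M N \<phi>])
    show "map_rep \<phi> c d' y = (transition d d' \<circ> map_rep \<phi> c d) y"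
      if "y \<in> coord c ` (dom_of c \<inter> \<phi> -` dom_of d)" for y
      using that by (auto simp: map_rep_coord[OF M] transition_def param_coord[OF atlas_chart[OF N]])
  qed (use p in auto)
  also have "\<dots> = K ** J"
    unfolding K_def J_def map_rep_coord[OF M p(1), symmetric]
    by (intro jacobian_compose map_rep_differentiable[OF \<phi> M(2) N(2) p])
      (simp add: map_rep_coord[OF M p(1)] transition_differentiable[OF N d'(1) p(2) d'(2)])
  finally have J': "jacobian (map_rep \<phi> c d') (at (coord c p)) = K ** J" .
  have "h d (\<phi> p) = transpose K ** h d' (\<phi> p) ** K"
    using h N d' p unfolding riemannian_metric_def K_def Let_def by blast
  then show ?thesis
    unfolding pullback_metric_def Let_def d'_def[symmetric] J'
    by (simp add: matrix_transpose_mul matrix_mul_assoc)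
qed

lemma riemannian_metric_positive:
  "riemannian_metric N h \<Longrightarrow> d \<in> atlas N \<Longrightarrow> q \<in> dom_of d \<Longrightarrow> positive_metric (h d q)"
  by (simp add: riemannian_metric_def positive_metric_def)

lemma local_conformal_immersion_charts:
  assumes M: "smooth_manifold M" "c \<in> atlas M" and N: "smooth_manifold N" "d \<in> atlas N"
    and h: "riemannian_metric N h" and \<phi>: "immersion M N \<phi>" and \<rho>: "smooth_function M \<rho>"
  shows "local_conformal_immersion (coord c ` (dom_of c \<inter> \<phi> -` dom_of d)) (coord d ` dom_of d)
    (map_rep \<phi> c d) (metric_rep h d) (\<rho> \<circ> param c)
    (metric_rep (pullback_metric N h \<phi>) c)
    (metric_rep (conformal_change \<rho> (pullback_metric N h \<phi>)) c)"
proof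
  have sm: "smooth_map M N \<phi>" using \<phi> by (simp add: immersion_def)
  let ?U = "coord c ` (dom_of c \<inter> \<phi> -` dom_of d)"
  show "open ?U" by (rule open_coord_map_dom[OF M N sm])
  show "open (coord d ` dom_of d)" by (rule open_coord_dom[OF N])
  show "map_rep \<phi> c d x \<in> coord d ` dom_of d" if "x \<in> ?U" for x
    using that by (auto simp: map_rep_coord[OF M])
  show "smooth_on ?U (map_rep \<phi> c d)" using sm M N by (simp add: smooth_map_def)
  show "smooth_on (coord d ` dom_of d) (metric_rep h d)" using h N by (simp add: riemannian_metric_def)
  show "positive_metric (metric_rep h d y)" if "y \<in> coord d ` dom_of d" for y
    using that by (auto simp: metric_rep_coord[OF N] riemannian_metric_positive[OF h N(2)])
  show "inj (dirder (map_rep \<phi> c d) x)" if "x \<in> ?U" for x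
    using that \<phi> M N by (auto simp: immersion_def)
  have "smooth_on (coord c ` dom_of c) (\<rho> \<circ> param c)" using \<rho> M by (simp add: smooth_function_def)
  then show "smooth_on ?U (\<rho> \<circ> param c)" by (rule smooth_on_subset) auto
  show "metric_rep (pullback_metric N h \<phi>) c x = transpose (jacobian (map_rep \<phi> c d) (at x))
      ** metric_rep h d (map_rep \<phi> c d x) ** jacobian (map_rep \<phi> c d) (at x)" if x: "x \<in> ?U" for x
  proof -
    obtain p where p: "p \<in> dom_of c" "\<phi> p \<in> dom_of d" "x = coord c p" using x by auto
    then show ?thesis
      using pullback_metric_chart[OF M N h sm p(1,2)]
      by (simp add: metric_rep_coord[OF M] metric_rep_coord[OF N] map_rep_coord[OF M])
  qed
  show "metric_rep (conformal_change \<rho> (pullback_metric N h \<phi>)) c x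
      = exp (2 * (\<rho> \<circ> param c) x) *\<^sub>R metric_rep (pullback_metric N h \<phi>) c x" for x
    by (simp add: metric_rep_def conformal_change_def)
qed

lemma pullback_riemannian_metric:
  fixes M :: "('a, 'm::finite) mfd" and N :: "('b, 'n::finite) mfd"
  assumes M: "smooth_manifold M" and N: "smooth_manifold N"
    and h: "riemannian_metric N h" and \<phi>: "immersion M N \<phi>"
  shows "riemannian_metric M (pullback_metric N h \<phi>)"
proof -
  let ?g = "pullback_metric N h \<phi> :: ('a, 'm) tensor2"
  have sm: "smooth_map M N \<phi>" using \<phi> by (simp add: immersion_def)
  \<comment> \<open>Exponent zero is an auxiliary choice that opens the local theory for facts about
    Gb alone.\<close>
  have zero: "smooth_function M (\<lambda>p. 0)"
    by (simp add: smooth_function_def o_def smooth_on_const)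
  note loc = local_conformal_immersion_charts[OF M _ N _ h \<phi> zero]
  have target: "\<exists>d\<in>atlas N. \<phi> p \<in> dom_of d" if "c \<in> atlas M" "p \<in> dom_of c" for c p
  proof -
    have "\<phi> p \<in> topspace (mtop N)"
      using sm chart_topspace[OF M that] by (auto simp: smooth_map_def continuous_map_def)
    then show ?thesis using atlas_cover[OF N] by metis
  qed
  \<comment> \<open>The domain of c need not be mapped into a single chart of N, so smoothness is
    checked near each point.\<close>
  have "smooth_on (coord c ` dom_of c) (metric_rep ?g c)" if c: "c \<in> atlas M" for c
  proof (rule smooth_on_local)
    fix x assume "x \<in> coord c ` dom_of c"
    then obtain p d where "p \<in> dom_of c" "x = coord c p" and d: "d \<in> atlas N" "\<phi> p \<in> dom_of d"
      using target[OF c] by blast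
    then have "x \<in> coord c ` (dom_of c \<inter> \<phi> -` dom_of d)" by auto
    then show "\<exists>V. open V \<and> x \<in> V \<and> smooth_on V (metric_rep ?g c)"
      using local_conformal_immersion.smooth_Gb[OF loc[OF c d(1)]] open_coord_map_dom[OF M c N d(1) sm]
      by blast
  qed
  moreover have "positive_metric (?g c p)" if c: "c \<in> atlas M" and p: "p \<in> dom_of c" for c p
  proof -
    obtain d where d: "d \<in> atlas N" "\<phi> p \<in> dom_of d" using target[OF c p] by blast
    have "coord c p \<in> coord c ` (dom_of c \<inter> \<phi> -` dom_of d)" using p d by auto
    from local_conformal_immersion.pos_Gb[OF loc[OF c d(1)] this]
    show ?thesis by (simp add: metric_rep_coord[OF M c p])
  qed
  moreover have "?g c p = transpose J ** ?g c' p ** J"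
    if c: "c \<in> atlas M" "c' \<in> atlas M" and p: "p \<in> dom_of c" "p \<in> dom_of c'"
      and J: "J = jacobian (transition c c') (at (coord c p))" for c c' p J
  proof -
    obtain d where d: "d \<in> atlas N" "\<phi> p \<in> dom_of d" using target[OF c(1) p(1)] by blast
    \<comment> \<open>Both metrics are computed with the same chart d of N; then only the chain rule
      in the source remains.\<close>
    have "jacobian (map_rep \<phi> c d) (at (coord c p))
        = jacobian (map_rep \<phi> c' d \<circ> transition c c') (at (coord c p))"
    proof (rule jacobian_cong_open)
      show "open (coord c ` (dom_of c \<inter> dom_of c'))" by (rule open_coord_overlap[OF M c])
      show "map_rep \<phi> c d y = (map_rep \<phi> c' d \<circ> transition c c') y"
        if "y \<in> coord c ` (dom_of c \<inter> dom_of c')" for y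
        using that by (auto simp: map_rep_coord[OF M] c transition_def param_coord[OF atlas_chart[OF M]])
    qed (use p in auto)
    also have "\<dots> = jacobian (map_rep \<phi> c' d) (at (transition c c' (coord c p))) ** J"
      unfolding J using transition_differentiable[OF M c p] map_rep_differentiable[OF sm c(2) d(1) p(2) d(2)]
      by (intro jacobian_compose) (simp_all add: transition_def param_coord[OF atlas_chart[OF M c(1)] p(1)])
    finally have "jacobian (map_rep \<phi> c d) (at (coord c p)) = jacobian (map_rep \<phi> c' d) (at (coord c' p)) ** J"
      by (simp add: transition_def param_coord[OF atlas_chart[OF M c(1)] p(1)])
    then show ?thesis
      by (simp add: pullback_metric_chart[OF M c(1) N d(1) h sm p(1) d(2)]
          pullback_metric_chart[OF M c(2) N d(1) h sm p(2) d(2)] matrix_transpose_mul matrix_mul_assoc)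
  qed
  ultimately show ?thesis
    unfolding riemannian_metric_def positive_metric_def Let_def by blast
qed

section \<open>Passage from charts to the whole manifold\<close>

lemma smooth_function_continuous:
  assumes M: "smooth_manifold M" and \<rho>: "smooth_function M \<rho>"
  shows "continuous_map (mtop M) euclideanreal \<rho>"
  unfolding continuous_map_def
proof (intro conjI allI impI)
  fix W :: "real set" assume "openin euclideanreal W"
  then have W: "open W" by simp
  show "openin (mtop M) {p \<in> topspace (mtop M). \<rho> p \<in> W}"
  proof (subst openin_subopen, intro ballI)
    fix p assume "p \<in> {p \<in> topspace (mtop M). \<rho> p \<in> W}"
    then have p: "p \<in> topspace (mtop M)" "\<rho> p \<in> W" by auto
    obtain c where c: "c \<in> atlas M" "p \<in> dom_of c" using atlas_cover[OF M p(1)] .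
    have "continuous_on (coord c ` dom_of c) (\<rho> \<circ> param c)"
      using \<rho> c by (intro smooth_on_continuous) (simp add: smooth_function_def)
    from continuous_open_preimage[OF this open_coord_dom[OF M c(1)] W]
    have "openin (mtop M) {q \<in> dom_of c. coord c q \<in> coord c ` dom_of c \<inter> (\<rho> \<circ> param c) -` W}"
      by (rule openin_coord_preimage[OF atlas_chart[OF M c(1)]])
    then show "\<exists>T. openin (mtop M) T \<and> p \<in> T \<and> T \<subseteq> {p \<in> topspace (mtop M). \<rho> p \<in> W}"
      using p c chart_topspace[OF M c(1)]
      by (intro exI conjI) (assumption,
          auto simp: param_coord[OF atlas_chart[OF M c(1)]] dest: inj_onD[OF chart_inj_on[OF atlas_chart[OF M c(1)]]])
  qed
qed auto

text \<open>On a nonempty compact space the maximum exists; the set where it is attained is closed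
  by continuity and open by assumption, hence everything by connectedness. Openness is asked for
  every upper bound, so it can be checked without knowing whether the bound is attained.\<close>

lemma constant_if_max_set_open:
  assumes X: "compact_space X" "connected_space X" and \<rho>: "continuous_map X euclideanreal \<rho>"
    and max: "\<And>K. (\<And>p. p \<in> topspace X \<Longrightarrow> \<rho> p \<le> K) \<Longrightarrow> openin X {p \<in> topspace X. \<rho> p = K}"
  shows "\<exists>k. \<forall>p\<in>topspace X. \<rho> p = k"
proof (cases "topspace X = {}")
  case False
  have "compact (\<rho> ` topspace X)"
    using image_compactin[OF _ \<rho>, of "topspace X"] X(1) by (simp add: compact_space_def)
  then obtain K where K: "K \<in> \<rho> ` topspace X" "\<And>p. p \<in> topspace X \<Longrightarrow> \<rho> p \<le> K"
    using compact_attains_sup[of "\<rho> ` topspace X"] False by auto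
  have "closedin X {p \<in> topspace X. \<rho> p \<in> {K}}"
    by (rule closedin_continuous_map_preimage[OF \<rho>]) simp
  then have "closedin X {p \<in> topspace X. \<rho> p = K}" by simp
  with max[OF K(2)] have "{p \<in> topspace X. \<rho> p = K} = {} \<or> {p \<in> topspace X. \<rho> p = K} = topspace X"
    using X(2) unfolding connected_space_clopen_in by blast
  then show ?thesis using K(1) by blast
qed auto

theorem proposition3p13:
  fixes M :: "('a, 4) mfd" and N :: "('b, 'n::finite) mfd"
    and h :: "('b, 'n) tensor2" and \<phi> :: "'a \<Rightarrow> 'b" and \<rho> :: "'a \<Rightarrow> real"
  assumes "smooth_manifold N" and "riemannian_metric N h"
    and "smooth_manifold M" and "compact_space (mtop M)" and "orientable M"
    and "immersion M N \<phi>" and "smooth_function M \<rho>"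
    and "stress_energy_vanishes M (conformal_change \<rho> (pullback_metric N h \<phi>)) N h \<phi>"
  shows "(\<exists>k. \<forall>p\<in>topspace (mtop M). \<rho> p = k)
    \<and> riemannian_immersion M (pullback_metric N h \<phi>) N h \<phi>
    \<and> pseudo_umbilical M (pullback_metric N h \<phi>) N h \<phi>"
proof -
  note N = assms(1) and h = assms(2) and M = assms(3) and \<phi> = assms(6) and \<rho> = assms(7) and S = assms(8)
  note loc = local_conformal_immersion_charts[OF M _ N _ h \<phi> \<rho>]
  have sm: "smooth_map M N \<phi>" using \<phi> by (simp add: immersion_def)
  have stress: "bienergy_stress (metric_rep (conformal_change \<rho> (pullback_metric N h \<phi>)) c)
      (metric_rep h d) (map_rep \<phi> c d) x X Y = 0"
    if "c \<in> atlas M" "d \<in> atlas N" "x \<in> coord c ` (dom_of c \<inter> \<phi> -` dom_of d)" for c d x X Y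
    using S that unfolding stress_energy_vanishes_def by blast
  have dim: "CARD(4) = 4" by simp
  have "\<exists>k. \<forall>p\<in>topspace (mtop M). \<rho> p = k"
  proof (rule constant_if_max_set_open)
    show "compact_space (mtop M)" "connected_space (mtop M)" "continuous_map (mtop M) euclideanreal \<rho>"
      using assms smooth_function_continuous by (auto simp: smooth_manifold_def)
    fix K assume K: "\<And>p. p \<in> topspace (mtop M) \<Longrightarrow> \<rho> p \<le> K"
    show "openin (mtop M) {p \<in> topspace (mtop M). \<rho> p = K}"
    proof (subst openin_subopen, intro ballI)
      fix p assume "p \<in> {p \<in> topspace (mtop M). \<rho> p = K}"
      then have p: "p \<in> topspace (mtop M)" "\<rho> p = K" by auto
      obtain c where c: "c \<in> atlas M" "p \<in> dom_of c" using atlas_cover[OF M p(1)] .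
      have "\<phi> p \<in> topspace (mtop N)" using sm p by (auto simp: smooth_map_def continuous_map_def)
      then obtain d where d: "d \<in> atlas N" "\<phi> p \<in> dom_of d" using atlas_cover[OF N] by metis
      let ?U = "coord c ` (dom_of c \<inter> \<phi> -` dom_of d)"
      have r: "(\<rho> \<circ> param c) (coord c q) = \<rho> q" if "q \<in> dom_of c" for q
        using param_coord[OF atlas_chart[OF M c(1)] that] by simp
      have "open {x \<in> ?U. (\<rho> \<circ> param c) x = K}"
      proof (rule local_conformal_immersion.max_set_open[OF loc[OF c(1) d(1)] dim])
        show "(\<rho> \<circ> param c) x \<le> K" if "x \<in> ?U" for x
          using that r K chart_topspace[OF M c(1)] by fastforce
      qed (rule stress[OF c(1) d(1)])
      \<comment> \<open>Pulled back along c, the coordinate set becomes an open neighbourhood of p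
        on which \<rho> equals K.\<close>
      then have "openin (mtop M) {q \<in> dom_of c. coord c q \<in> {x \<in> ?U. (\<rho> \<circ> param c) x = K}}"
        by (rule openin_coord_preimage[OF atlas_chart[OF M c(1)]])
      then show "\<exists>T. openin (mtop M) T \<and> p \<in> T \<and> T \<subseteq> {p \<in> topspace (mtop M). \<rho> p = K}"
        using p c d r chart_topspace[OF M c(1)] by (intro exI conjI) (assumption,
            auto dest: inj_onD[OF chart_inj_on[OF atlas_chart[OF M c(1)]]])
    qed
  qed
  then obtain k where k: "\<And>p. p \<in> topspace (mtop M) \<Longrightarrow> \<rho> p = k" by blast
  moreover have "riemannian_immersion M (pullback_metric N h \<phi>) N h \<phi>"
    using pullback_riemannian_metric[OF M N h \<phi>] \<phi> by (simp add: riemannian_immersion_def)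
  moreover have "pseudo_umbilical M (pullback_metric N h \<phi>) N h \<phi>"
    unfolding pseudo_umbilical_def Let_def
  proof (intro ballI allI)
    fix c d p X Y
    assume c: "c \<in> atlas M" and d: "d \<in> atlas N" and p: "p \<in> dom_of c \<inter> \<phi> -` dom_of d"
    \<comment> \<open>The local lemma wants one constant on the whole coordinate domain; the global
      k provides it.\<close>
    have "(\<rho> \<circ> param c) y = k" if "y \<in> coord c ` (dom_of c \<inter> \<phi> -` dom_of d)" for y
      using that k chart_topspace[OF M c] by (auto simp: param_coord[OF atlas_chart[OF M c]])
    from local_conformal_immersion.pseudo_umbilical_if_constant[OF loc[OF c d] _ dim stress[OF c d] this,
        of "coord c p" X Y]
    show "metric_inner (h d (\<phi> p))
        (hess_map (metric_rep (pullback_metric N h \<phi>) c) (metric_rep h d) (map_rep \<phi> c d) (coord c p) X Y)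
        (tension (metric_rep (pullback_metric N h \<phi>) c) (metric_rep h d) (map_rep \<phi> c d) (coord c p))
      = 1 / real CARD(4) * metric_inner (h d (\<phi> p))
        (tension (metric_rep (pullback_metric N h \<phi>) c) (metric_rep h d) (map_rep \<phi> c d) (coord c p))
        (tension (metric_rep (pullback_metric N h \<phi>) c) (metric_rep h d) (map_rep \<phi> c d) (coord c p))
        * metric_inner (pullback_metric N h \<phi> c p) X Y"
      using p by (simp add: map_rep_coord[OF M c] metric_rep_coord[OF M c] metric_rep_coord[OF N d])
  qed
  ultimately show ?thesis by blast
qed

end
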